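(* Let $\Gamma\subset\mathbf{P}^r=\mathbf{P}(V)$ be a nondegenerate finite Gorenstein scheme of degree $2r+2$ over an algebraically closed field $k$. The following are equivalent: (a) $\Gamma$ is self-associated. (b) Each of the (finitely many) subschemes of degree $2r+1$ of $\Gamma$ imposes the same number of conditions on quadrics as $\Gamma$ does. (c) If we choose a generator of $\mathcal{O}_\Gamma(1)$, and thus identify $V$ with a subspace of $\mathcal{O}_\Gamma$, there is a linear form $\phi:\mathcal{O}_\Gamma\to k$ which vanishes on $V^2$ and which generates $\mathrm{Hom}_k(\mathcal{O}_\Gamma,k)$ as an $\mathcal{O}_\Gamma$-module.
   Context: A finite Gorenstein scheme over $k$ is a finite $k$-scheme with Gorenstein local rings; $K_\Gamma$ is its dualizing line bundle. $\mathbf{P}(V)$ is the projective space whose space of linear forms is $V$; $\Gamma$ is nondegenerate if it lies in no hyperplane, i.e. $V\subset\mathrm{H}^0(\mathcal{O}_\Gamma(1))$. Serre duality gives a trace map $\mathrm{H}^0(K_\Gamma)\to k$ and, via multiplication, a perfect pairing $\mathrm{H}^0(\mathcal{O}_\Gamma(1))\otimes\mathrm{H}^0(K_\Gamma(-1))\to k$; $V^\perp\subset\mathrm{H}^0(K_\Gamma(-1))$ is the annihilator of $V$ (the Gale transform of $\Gamma$). $\Gamma$ is self-associated if it equals its own Gale transform up to projective equivalence, i.e. if there is an isomorphism of $\mathcal{O}_\Gamma$-modules $\mathcal{O}_\Gamma(1)\to K_\Gamma(-1)$ carrying $V$ onto $V^\perp$. The number of conditions imposed by a subscheme $\Gamma'$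 on quadrics is the rank of the restriction map from quadratic forms on $\mathbf{P}^r$ to $\mathrm{H}^0(\mathcal{O}_{\Gamma'}(2))$. In (c), $V^2\subset\mathcal{O}_\Gamma$ is the $k$-span of products of two elements of $V$. *)

theory Defs
  imports
    "HOL-Computational_Algebra.Polynomial"
    "HOL-Library.Function_Algebras"
begin

text \<open>
  A finite scheme over a field \<open>k\<close> is affine, \<open>\<Gamma> = Spec A\<close> with \<open>A = H\<^sup>0(O\<^sub>\<Gamma>)\<close> a
  finite-dimensional \<open>k\<close>-algebra. Here \<open>A\<close> is a type \<open>'a::comm_ring_1\<close>, its \<open>k\<close>-algebra structure
  is a ring homomorphism \<open>\<iota> :: 'k \<Rightarrow> 'a\<close>, and a quasi-coherent sheaf on \<open>\<Gamma>\<close> is an \<open>A\<close>-module, given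
  by its scalar multiplication. Ideals of \<open>A\<close> are the submodules of \<open>A\<close>, i.e. the sets satisfying
  \<open>module.subspace (*)\<close>.
\<close>

definition kscale :: "('k \<Rightarrow> 'a) \<Rightarrow> ('a \<Rightarrow> 'm \<Rightarrow> 'm) \<Rightarrow> 'k \<Rightarrow> 'm \<Rightarrow> 'm" where
  "kscale \<iota> s = (\<lambda>c x. s (\<iota> c) x)"

definition pointwise :: "('a \<Rightarrow> 'm \<Rightarrow> 'm) \<Rightarrow> 'a \<Rightarrow> ('x \<Rightarrow> 'm) \<Rightarrow> ('x \<Rightarrow> 'm)" where
  "pointwise s = (\<lambda>a F x. s a (F x))"

definition algebra_map :: "('k::field \<Rightarrow> 'a::comm_ring_1) \<Rightarrow> bool" where
  "algebra_map \<iota> \<longleftrightarrow>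
     \<iota> 1 = 1 \<and> (\<forall>c d. \<iota> (c + d) = \<iota> c + \<iota> d) \<and> (\<forall>c d. \<iota> (c * d) = \<iota> c * \<iota> d)"

definition finite_scheme :: "('k::field \<Rightarrow> 'a::comm_ring_1) \<Rightarrow> bool" where
  "finite_scheme \<iota> \<longleftrightarrow>
     algebra_map \<iota> \<and> (\<exists>B. finite B \<and> module.span (kscale \<iota> (*)) B = UNIV)"

definition prime_ideal :: "'a::comm_ring_1 set \<Rightarrow> bool" where
  "prime_ideal p \<longleftrightarrow>
     module.subspace (*) p \<and> p \<noteq> UNIV \<and> (\<forall>a b. a * b \<in> p \<longrightarrow> a \<in> p \<or> b \<in> p)"

text \<open>\<open>vanishes_at p a\<close> says that \<open>a/1 = 0\<close> in the local ring \<open>A\<^sub>p\<close>.\<close>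

definition vanishes_at :: "'a::comm_ring_1 set \<Rightarrow> 'a \<Rightarrow> bool" where
  "vanishes_at p a \<longleftrightarrow> (\<exists>t. t \<notin> p \<and> t * a = 0)"

text \<open>
  The local rings of a finite scheme are Artinian. An Artinian local ring \<open>R\<close> with residue field
  \<open>\<kappa>\<close> is Gorenstein when its socle \<open>Hom\<^sub>R(\<kappa>, R)\<close> is one-dimensional over \<open>\<kappa>\<close>. For
  \<open>R = A\<^sub>p\<close> every element is a unit times some \<open>x/1\<close>, so the socle can be tested on the elements
  \<open>x/1\<close>; the definition says that it is generated by a single nonzero \<open>x/1\<close>.
\<close>

definition in_socle_at :: "'a::comm_ring_1 set \<Rightarrow> 'a \<Rightarrow> bool" where
  "in_socle_at p x \<longleftrightarrow> (\<forall>m\<in>p. vanishes_at p (m * x))"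

definition gorenstein_at :: "'a::comm_ring_1 set \<Rightarrow> bool" where
  "gorenstein_at p \<longleftrightarrow>
     (\<exists>x. in_socle_at p x \<and> \<not> vanishes_at p x \<and>
        (\<forall>y. in_socle_at p y \<longrightarrow> (\<exists>a t. t \<notin> p \<and> vanishes_at p (t * y - a * x))))"

definition finite_gorenstein_scheme :: "('k::field \<Rightarrow> 'a::comm_ring_1) \<Rightarrow> bool" where
  "finite_gorenstein_scheme \<iota> \<longleftrightarrow>
     finite_scheme \<iota> \<and> (\<forall>p::'a set. prime_ideal p \<longrightarrow> gorenstein_at p)"

text \<open>The degree of the closed subscheme \<open>Spec (A/I)\<close>, i.e. the \<open>k\<close>-dimension of \<open>A/I\<close>.\<close>

definition subscheme_degree :: "('k::field \<Rightarrow> 'a::comm_ring_1) \<Rightarrow> 'a set \<Rightarrow> nat" where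
  "subscheme_degree \<iota> I =
     vector_space.dim (kscale \<iota> (*)) (UNIV :: 'a set) - vector_space.dim (kscale \<iota> (*)) I"

text \<open>
  Local freeness of rank one: each point has a basic open neighbourhood \<open>D(f)\<close> over which the
  localized module \<open>L\<^sub>f\<close> is free over \<open>A\<^sub>f\<close> with basis some \<open>g/1\<close> (denominators of a basis are
  units of \<open>A\<^sub>f\<close>).
\<close>

definition line_bundle :: "('a::comm_ring_1 \<Rightarrow> 'l::ab_group_add \<Rightarrow> 'l) \<Rightarrow> bool" where
  "line_bundle s \<longleftrightarrow> module s \<and>
     (\<forall>p. prime_ideal p \<longrightarrow>
        (\<exists>f g. f \<notin> p \<and>
           (\<forall>x. \<exists>n a. s (f ^ n) x = s a g) \<and>
           (\<forall>a. s a g = 0 \<longrightarrow> (\<exists>n. f ^ n * a = 0))))"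

definition generates :: "('a::comm_ring_1 \<Rightarrow> 'l::ab_group_add \<Rightarrow> 'l) \<Rightarrow> 'l \<Rightarrow> bool" where
  "generates s g \<longleftrightarrow> module.span s {g} = UNIV"

text \<open>
  A generator \<open>g\<close> of \<open>L\<close> identifies \<open>a \<in> A\<close> with \<open>a g \<in> L\<close>; \<open>coords s g \<rho>\<close> is the image of \<open>V\<close>
  in \<open>A\<close> under this identification, and \<open>forms \<iota> W n\<close> is the \<open>k\<close>-span of the \<open>n\<close>-fold products of
  elements of \<open>W \<subseteq> A\<close>.
\<close>

definition coords :: "('a \<Rightarrow> 'l \<Rightarrow> 'l) \<Rightarrow> 'l \<Rightarrow> ('v \<Rightarrow> 'l) \<Rightarrow> 'a set" where
  "coords s g \<rho> = {a. s a g \<in> range \<rho>}"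

definition forms :: "('k::field \<Rightarrow> 'a::comm_ring_1) \<Rightarrow> 'a set \<Rightarrow> nat \<Rightarrow> 'a set" where
  "forms \<iota> W n = module.span (kscale \<iota> (*)) {\<Prod>i<n. w i |w. \<forall>i<n. w i \<in> W}"

text \<open>
  A morphism \<open>\<Gamma> \<rightarrow> P(V)\<close> is a line bundle \<open>L = O\<^sub>\<Gamma>(1)\<close> together with a linear map \<open>\<rho> : V \<rightarrow> H\<^sup>0(L)\<close>
  whose image generates \<open>L\<close>. The preimage of the affine chart \<open>D\<^sub>+(v)\<close>, where \<open>v\<close> restricts to
  \<open>a g\<close>, is \<open>Spec A\<^sub>a\<close>, and the morphism is a closed immersion iff for all \<open>v\<close> the ring
  homomorphism \<open>(Sym V)[1/v]\<^sub>0 \<rightarrow> A\<^sub>a\<close> is surjective: every \<open>c/a\<^sup>j\<close> equals \<open>y/a\<^sup>n\<close> in \<open>A\<^sub>a\<close> for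
  some form \<open>y\<close> of degree \<open>n\<close>. A global generator \<open>g\<close> exists since \<open>\<Gamma>\<close> is finite, and the
  condition does not depend on it.
\<close>

definition projective_embedding ::
  "('k::field \<Rightarrow> 'a::comm_ring_1) \<Rightarrow> ('a \<Rightarrow> 'l::ab_group_add \<Rightarrow> 'l) \<Rightarrow>
   ('k \<Rightarrow> 'v::ab_group_add \<Rightarrow> 'v) \<Rightarrow> ('v \<Rightarrow> 'l) \<Rightarrow> bool" where
  "projective_embedding \<iota> s sV \<rho> \<longleftrightarrow>
     line_bundle s \<and>
     Vector_Spaces.linear sV (kscale \<iota> s) \<rho> \<and>
     module.span s (range \<rho>) = UNIV \<and>
     (\<forall>g. generates s g \<longrightarrow>
        (\<forall>v a. \<rho> v = s a g \<longrightarrow>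
           (\<forall>c j. \<exists>n. \<exists>y \<in> forms \<iota> (coords s g \<rho>) n. \<exists>m.
              a ^ m * (a ^ n * c) = a ^ m * (a ^ j * y))))"

definition nondegenerate :: "('v \<Rightarrow> 'l) \<Rightarrow> bool" where
  "nondegenerate \<rho> \<longleftrightarrow> inj \<rho>"

text \<open>The dualizing module \<open>H\<^sup>0(K\<^sub>\<Gamma>) = Hom\<^sub>k(A, k)\<close>, with \<open>(a \<phi>)(b) = \<phi>(a b)\<close>.\<close>

definition dualizing :: "('k::field \<Rightarrow> 'a::comm_ring_1) \<Rightarrow> ('a \<Rightarrow> 'k) set" where
  "dualizing \<iota> = {\<phi>. Vector_Spaces.linear (kscale \<iota> (*)) (*) \<phi>}"

definition dual_act :: "'a::comm_ring_1 \<Rightarrow> ('a \<Rightarrow> 'k) \<Rightarrow> ('a \<Rightarrow> 'k)" where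
  "dual_act a \<phi> = (\<lambda>b. \<phi> (a * b))"

definition trace :: "('a::comm_ring_1 \<Rightarrow> 'k) \<Rightarrow> 'k" where
  "trace \<phi> = \<phi> 1"

text \<open>
  \<open>H\<^sup>0(K\<^sub>\<Gamma>(-1)) = Hom\<^sub>A(L, Hom\<^sub>k(A, k))\<close>; the multiplication
  \<open>O\<^sub>\<Gamma>(1) \<otimes> K\<^sub>\<Gamma>(-1) \<rightarrow> K\<^sub>\<Gamma>\<close> is evaluation.
\<close>

definition dualizing_twist ::
  "('k::field \<Rightarrow> 'a::comm_ring_1) \<Rightarrow> ('a \<Rightarrow> 'l::ab_group_add \<Rightarrow> 'l) \<Rightarrow> ('l \<Rightarrow> 'a \<Rightarrow> 'k) set" where
  "dualizing_twist \<iota> s =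
     {\<psi>. (\<forall>x. \<psi> x \<in> dualizing \<iota>) \<and> (\<forall>x y. \<psi> (x + y) = \<psi> x + \<psi> y) \<and>
         (\<forall>a x. \<psi> (s a x) = dual_act a (\<psi> x))}"

definition gale_transform ::
  "('k::field \<Rightarrow> 'a::comm_ring_1) \<Rightarrow> ('a \<Rightarrow> 'l::ab_group_add \<Rightarrow> 'l) \<Rightarrow> ('v \<Rightarrow> 'l) \<Rightarrow>
   ('l \<Rightarrow> 'a \<Rightarrow> 'k) set" where
  "gale_transform \<iota> s \<rho> = {\<psi> \<in> dualizing_twist \<iota> s. \<forall>v. trace (\<psi> (\<rho> v)) = 0}"

definition self_associated ::
  "('k::field \<Rightarrow> 'a::comm_ring_1) \<Rightarrow> ('a \<Rightarrow> 'l::ab_group_add \<Rightarrow> 'l) \<Rightarrow> ('v \<Rightarrow> 'l) \<Rightarrow> bool" where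
  "self_associated \<iota> s \<rho> \<longleftrightarrow>
     (\<exists>\<Phi>. bij_betw \<Phi> UNIV (dualizing_twist \<iota> s) \<and>
          (\<forall>x y. \<Phi> (x + y) = \<Phi> x + \<Phi> y) \<and>
          (\<forall>a x. \<Phi> (s a x) = pointwise dual_act a (\<Phi> x)) \<and>
          \<Phi> ` range \<rho> = gale_transform \<iota> s \<rho>)"

text \<open>
  For a line bundle \<open>L\<close> with inverse \<open>L\<^sup>-\<^sup>1 = Hom\<^sub>A(L, A)\<close>, the module \<open>H\<^sup>0(O\<^sub>\<Gamma>(2)) = L \<otimes> L\<close> is
  \<open>Hom\<^sub>A(L\<^sup>-\<^sup>1, L)\<close>, the product of \<open>x\<close> and \<open>y\<close> being \<open>\<theta> \<mapsto> \<theta>(x) y\<close>. Elements of the Hom module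
  are total functions, made unique by the value \<open>0\<close> outside \<open>L\<^sup>-\<^sup>1\<close>.
\<close>

definition inverse_bundle :: "('a::comm_ring_1 \<Rightarrow> 'l::ab_group_add \<Rightarrow> 'l) \<Rightarrow> ('l \<Rightarrow> 'a) set" where
  "inverse_bundle s = {\<theta>. module_hom s (*) \<theta>}"

definition square_bundle ::
  "('a::comm_ring_1 \<Rightarrow> 'l::ab_group_add \<Rightarrow> 'l) \<Rightarrow> (('l \<Rightarrow> 'a) \<Rightarrow> 'l) set" where
  "square_bundle s =
     {F. (\<forall>\<theta>\<in>inverse_bundle s. \<forall>\<eta>\<in>inverse_bundle s. F (\<theta> + \<eta>) = F \<theta> + F \<eta>) \<and>
         (\<forall>a. \<forall>\<theta>\<in>inverse_bundle s. F (pointwise (*) a \<theta>) = s a (F \<theta>)) \<and>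
         (\<forall>\<theta>. \<theta> \<notin> inverse_bundle s \<longrightarrow> F \<theta> = 0)}"

definition square_mult ::
  "('a::comm_ring_1 \<Rightarrow> 'l::ab_group_add \<Rightarrow> 'l) \<Rightarrow> 'l \<Rightarrow> 'l \<Rightarrow> (('l \<Rightarrow> 'a) \<Rightarrow> 'l)" where
  "square_mult s x y = (\<lambda>\<theta>. if \<theta> \<in> inverse_bundle s then s (\<theta> x) y else 0)"

text \<open>The image of \<open>Sym\<^sup>2 V \<rightarrow> H\<^sup>0(O\<^sub>\<Gamma>(2))\<close>, and the kernel \<open>I H\<^sup>0(O\<^sub>\<Gamma>(2))\<close> of restriction to
  \<open>\<Gamma>' = Spec (A/I)\<close>.\<close>

definition quadrics ::
  "('k::field \<Rightarrow> 'a::comm_ring_1) \<Rightarrow> ('a \<Rightarrow> 'l::ab_group_add \<Rightarrow> 'l) \<Rightarrow> ('v \<Rightarrow> 'l) \<Rightarrow>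
   (('l \<Rightarrow> 'a) \<Rightarrow> 'l) set" where
  "quadrics \<iota> s \<rho> =
     module.span (kscale \<iota> (pointwise s)) {square_mult s (\<rho> v) (\<rho> w) |v w. True}"

definition square_vanishing ::
  "('a::comm_ring_1 \<Rightarrow> 'l::ab_group_add \<Rightarrow> 'l) \<Rightarrow> 'a set \<Rightarrow> (('l \<Rightarrow> 'a) \<Rightarrow> 'l) set" where
  "square_vanishing s I =
     module.span (pointwise s) {pointwise s a F |a F. a \<in> I \<and> F \<in> square_bundle s}"

text \<open>
  The rank of \<open>Sym\<^sup>2 V \<rightarrow> H\<^sup>0(O\<^sub>\<Gamma>\<^sub>'(2)) = H\<^sup>0(O\<^sub>\<Gamma>(2)) / I H\<^sup>0(O\<^sub>\<Gamma>(2))\<close>: the dimension of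
  \<open>(Q + N)/N\<close>, with \<open>Q\<close> the image of \<open>Sym\<^sup>2 V\<close> in \<open>H\<^sup>0(O\<^sub>\<Gamma>(2))\<close> and \<open>N = I H\<^sup>0(O\<^sub>\<Gamma>(2))\<close>.
\<close>

definition conditions_on_quadrics ::
  "('k::field \<Rightarrow> 'a::comm_ring_1) \<Rightarrow> ('a \<Rightarrow> 'l::ab_group_add \<Rightarrow> 'l) \<Rightarrow> ('v \<Rightarrow> 'l) \<Rightarrow>
   'a set \<Rightarrow> nat" where
  "conditions_on_quadrics \<iota> s \<rho> I =
     vector_space.dim (kscale \<iota> (pointwise s))
       {F + G |F G. F \<in> quadrics \<iota> s \<rho> \<and> G \<in> square_vanishing s I}
     - vector_space.dim (kscale \<iota> (pointwise s)) (square_vanishing s I)"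

end

theory Submission
  imports Defs "HOL-Library.FuncSet"
begin

text \<open>
  Let \<open>A\<close> be the coordinate ring of \<open>\<Gamma>\<close>. It is a finite-dimensional algebra, so \<open>O\<^sub>\<Gamma>(1)\<close> has a
  generator \<open>g\<close> and is free on it (\<open>line_bundle_has_generator\<close>,
  \<open>line_bundle_generator_is_free\<close>). In the coordinate given by \<open>g\<close> the space \<open>V\<close> becomes a subspace
  \<open>W \<subseteq> A\<close> whose dimension \<open>r + 1\<close> is half that of \<open>A\<close>, and \<open>H\<^sup>0(O\<^sub>\<Gamma>(2))\<close> becomes \<open>A\<close> with the
  image of the quadratic forms equal to \<open>W\<^sup>2\<close>.

  Self-association is a property of one functional. An isomorphism \<open>\<Phi> : O\<^sub>\<Gamma>(1) \<rightarrow> K\<^sub>\<Gamma>(-1)\<close> amounts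
  to the functional \<open>\<phi> = \<Phi>(g)(g)\<close>, which has to generate \<open>Hom\<^sub>k(A, k)\<close>; equivalently, the form
  \<open>(a, b) \<mapsto> \<phi>(ab)\<close> is nondegenerate. The isomorphism carries \<open>V\<close> onto its Gale transform exactly when
  \<open>W\<close> is its own orthogonal complement for this form. Since \<open>W\<close> has half the dimension
  of \<open>A\<close>, it is enough that \<open>W\<close> is isotropic, that is, that \<open>\<phi>\<close> vanishes on \<open>W\<^sup>2\<close>. This is condition
  (c).

  A subscheme of degree one less than \<open>\<Gamma>\<close> is cut out by a one-dimensional ideal \<open>I\<close>, and it imposes
  as many conditions on quadrics as \<open>\<Gamma>\<close> does exactly when \<open>I \<inter> W\<^sup>2 = 0\<close>, i.e. \<open>I\<close> is not contained
  in \<open>W\<^sup>2\<close> (\<open>same_conditions_iff\<close>). On the other hand \<open>\<phi>\<close> generates the dual iff its kernel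
  contains no nonzero ideal. Over an algebraically closed field every nonzero ideal contains a
  one-dimensional one (\<open>ex_weight_vector\<close>), so it is enough to look at these. Hence a generator that
  vanishes on \<open>W\<^sup>2\<close> keeps every such \<open>I\<close> out of \<open>W\<^sup>2\<close>. Conversely, a one-dimensional ideal is
  the whole socle at one of the finitely many points, by the Gorenstein property, so there are only
  finitely many of them; if none lies in \<open>W\<^sup>2\<close>, a functional in the annihilator of \<open>W\<^sup>2\<close> that avoids
  finitely many proper subspaces is nonzero on each of them
  (\<open>generator_vanishing_on_iff\<close>). Such a functional exists because \<open>k\<close> is infinite.
\<close>

section \<open>Avoiding finitely many subspaces\<close>

text \<open>
  Over a finite field the polynomial \<open>1 + \<Prod>\<^sub>c (X - c)\<close> would have no root.
\<close>

lemma infinite_alg_closed_field: "infinite (UNIV :: 'k::alg_closed_field set)"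
proof
  assume fin: "finite (UNIV :: 'k set)"
  define p :: "'k poly" where "p = (\<Prod>c\<in>UNIV. [:- c, 1:])"
  have "degree p = card (UNIV :: 'k set)"
    unfolding p_def by (subst degree_prod_sum_eq) auto
  then have "degree (p + 1) > 0"
    using fin by (simp add: card_gt_0_iff degree_add_eq_left)
  then obtain x where "poly (p + 1) x = 0"
    using alg_closed_imp_poly_has_root by blast
  moreover have "poly p x = 0"
    using fin by (auto simp: p_def poly_prod prod_zero_iff)
  ultimately show False by simp
qed

lemma (in vector_space) avoid_finitely_many_subspaces:
  assumes inf: "infinite (UNIV :: 'a set)" and "finite F" and U: "subspace U"
    and F: "\<And>S. S \<in> F \<Longrightarrow> subspace S \<and> \<not> U \<subseteq> S"
  shows "\<exists>u\<in>U. \<forall>S\<in>F. u \<notin> S"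
  using \<open>finite F\<close> F
proof (induction F)
  case empty
  then show ?case using subspace_0[OF U] by blast
next
  case (insert T F)
  then obtain u where u: "u \<in> U" "\<forall>S\<in>F. u \<notin> S" by auto
  obtain v where v: "v \<in> U" "v \<notin> T" using insert.prems[of T] by auto
  define bad where "bad S = {c. u + scale c v \<in> S}" for S
  \<comment> \<open>Since \<open>u \<notin> S\<close> or \<open>v \<notin> S\<close>, the line \<open>c \<mapsto> u + c v\<close> is not contained in \<open>S\<close>, so it meets \<open>S\<close> at most once.\<close>
  have "c = d" if S: "S \<in> insert T F" and c: "c \<in> bad S" and d: "d \<in> bad S" for S c d
  proof (rule ccontr)
    assume "c \<noteq> d"
    have sS: "subspace S" using insert.prems S by blast
    have "(u + scale c v) - (u + scale d v) \<in> S"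
      using c d by (intro subspace_diff[OF sS]) (auto simp: bad_def)
    then have "scale (c - d) v \<in> S" by (simp add: scale_left_diff_distrib)
    then have "scale (inverse (c - d)) (scale (c - d) v) \<in> S" by (rule subspace_scale[OF sS])
    then have vS: "v \<in> S" using \<open>c \<noteq> d\<close> by simp
    have "(u + scale c v) - scale c v \<in> S"
      using c vS by (intro subspace_diff[OF sS] subspace_scale[OF sS]) (auto simp: bad_def)
    with vS show False using S u v by auto
  qed
  then have "finite (bad S)" if "S \<in> insert T F" for S
    using that finite_subset[of "bad S" "{SOME c. c \<in> bad S}"] by (metis finite.simps someI subsetI singletonI)
  then have "finite (\<Union>S\<in>insert T F. bad S)" using insert.hyps by blast
  then obtain c where "c \<notin> (\<Union>S\<in>insert T F. bad S)" using inf ex_new_if_finite by blast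
  then show ?case
    using u(1) v(1) by (intro bexI[of _ "u + scale c v"] subspace_add[OF U] subspace_scale[OF U])
      (auto simp: bad_def)
qed

section \<open>Ideals and modules\<close>

abbreviation ideal :: "'a::comm_ring_1 set \<Rightarrow> bool" where
  "ideal \<equiv> module.subspace (*)"

lemma module_mult: "module ((*) :: 'a::comm_ring_1 \<Rightarrow> 'a \<Rightarrow> 'a)"
  by unfold_locales (simp_all add: algebra_simps)

lemma generates_iff: "module s \<Longrightarrow> generates s g \<longleftrightarrow> (\<forall>x. \<exists>a. x = s a g)"
  by (auto simp: generates_def module.span_singleton)

lemma module_pointwise: "module s \<Longrightarrow> module (pointwise s)"
  by (rule module.intro)
    (simp_all add: pointwise_def fun_eq_iff module.scale_right_distrib module.scale_left_distrib
      module.scale_scale module.scale_one)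

lemma ideal_iff:
  "ideal I \<longleftrightarrow> 0 \<in> I \<and> (\<forall>x\<in>I. \<forall>y\<in>I. x + y \<in> I) \<and> (\<forall>a. \<forall>x\<in>I. a * x \<in> I)"
  by (auto simp: module.subspace_def[OF module_mult])

lemma ideal_diff: "ideal I \<Longrightarrow> x \<in> I \<Longrightarrow> y \<in> I \<Longrightarrow> x - y \<in> I"
  by (rule module.subspace_diff[OF module_mult])

lemma one_notin_prime_ideal:
  assumes p: "prime_ideal p"
  shows "1 \<notin> p"
proof
  assume "1 \<in> p"
  then have "a * 1 \<in> p" for a using p unfolding prime_ideal_def ideal_iff by blast
  then show False using p by (auto simp: prime_ideal_def)
qed

lemma power_notin_prime_ideal: "prime_ideal p \<Longrightarrow> f \<notin> p \<Longrightarrow> f ^ n \<notin> p"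
  by (induction n) (auto simp: one_notin_prime_ideal prime_ideal_def)

section \<open>Finite-dimensional algebras over an algebraically closed field\<close>

locale finite_algebra =
  fixes \<iota> :: "'k::alg_closed_field \<Rightarrow> 'a::comm_ring_1"
  assumes finite_scheme: "finite_scheme \<iota>"
begin

lemma scalar_one [simp]: "\<iota> 1 = 1"
  and scalar_add: "\<iota> (c + d) = \<iota> c + \<iota> d"
  and scalar_mult: "\<iota> (c * d) = \<iota> c * \<iota> d"
  using finite_scheme by (auto simp: finite_scheme_def algebra_map_def)

lemma scalar_zero [simp]: "\<iota> 0 = 0"
  using scalar_add[of 0 0] by simp

lemma scalar_minus: "\<iota> (- c) = - \<iota> c"
  using scalar_add[of c "- c"] by (simp add: eq_neg_iff_add_eq_0 add.commute)

lemma scalar_diff: "\<iota> (c - d) = \<iota> c - \<iota> d"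
  using scalar_add[of "c - d" d] by simp

lemma left_inverse: "c \<noteq> 0 \<Longrightarrow> \<iota> (inverse c) * \<iota> c = 1"
  by (simp flip: scalar_mult)

lemma vector_space_kscale: "module s \<Longrightarrow> vector_space (kscale \<iota> s)"
  by (rule vector_space.intro)
    (simp_all add: kscale_def scalar_add scalar_mult module.scale_right_distrib module.scale_left_distrib
      module.scale_scale module.scale_one)

sublocale vs: vector_space "kscale \<iota> (*)"
  by (rule vector_space_kscale[OF module_mult])

lemma kscale_mult [simp]: "kscale \<iota> (*) c a = \<iota> c * a"
  by (simp add: kscale_def)

text \<open>
  A fixed basis makes the results on finite-dimensional vector spaces available, since these are
  stated relative to one.
\<close>

definition basis :: "'a set" where
  "basis = (SOME B. finite B \<and> vs.independent B \<and> vs.span B = UNIV)"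

lemma basis: "finite basis \<and> vs.independent basis \<and> vs.span basis = UNIV"
proof -
  obtain S where S: "finite S" "vs.span S = UNIV"
    using finite_scheme by (auto simp: finite_scheme_def)
  obtain B where "B \<subseteq> S" "vs.independent B" "S \<subseteq> vs.span B"
    using vs.maximal_independent_subset[of S] by blast
  then have "finite B \<and> vs.independent B \<and> vs.span B = UNIV"
    using S finite_subset vs.span_mono vs.span_span by (metis top.extremum_uniqueI)
  then show ?thesis unfolding basis_def by (rule someI)
qed

sublocale vs: finite_dimensional_vector_space "kscale \<iota> (*)" basis
  using basis by unfold_locales auto

sublocale endo: finite_dimensional_vector_space_pair "kscale \<iota> (*)" basis "kscale \<iota> (*)" basis
  by unfold_locales

lemma vector_space_field: "vector_space ((*) :: 'k \<Rightarrow> 'k \<Rightarrow> 'k)"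
  by unfold_locales (simp_all add: algebra_simps)

sublocale functional: finite_dimensional_vector_space_pair_1 "kscale \<iota> (*)" basis "(*) :: 'k \<Rightarrow> 'k \<Rightarrow> 'k"
  using vector_space_field
  by (intro finite_dimensional_vector_space_pair_1.intro vs.finite_dimensional_vector_space_axioms)

lemma subspace_iff:
  "vs.subspace S \<longleftrightarrow> 0 \<in> S \<and> (\<forall>x\<in>S. \<forall>y\<in>S. x + y \<in> S) \<and> (\<forall>c. \<forall>x\<in>S. \<iota> c * x \<in> S)"
  by (auto simp: vs.subspace_def)

lemma ideal_imp_subspace: "ideal I \<Longrightarrow> vs.subspace I"
  by (auto simp: subspace_iff ideal_iff)

lemma in_dualizing_iff:
  "\<phi> \<in> dualizing \<iota> \<longleftrightarrow> (\<forall>x y. \<phi> (x + y) = \<phi> x + \<phi> y) \<and> (\<forall>c x. \<phi> (\<iota> c * x) = c * \<phi> x)"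
  by (auto simp: dualizing_def Vector_Spaces.linear_iff vs.vector_space_axioms vector_space_field)

lemma map_poly_hom_add: "map_poly \<iota> (f + g) = map_poly \<iota> f + map_poly \<iota> g"
  by (rule poly_eqI) (simp add: coeff_map_poly scalar_add)

text \<open>
  Evaluation at \<open>a\<close> is a ring homomorphism \<open>k[X] \<rightarrow> A\<close>, and polynomials over \<open>k\<close> split into linear
  factors.
\<close>

lemma eval_splits:
  assumes "p \<noteq> 0"
  shows "\<exists>c cs. c \<noteq> 0 \<and> poly (map_poly \<iota> p) a = \<iota> c * (\<Prod>d\<leftarrow>cs. a - \<iota> d)"
  using assms
proof (induction "degree p" arbitrary: p)
  case 0
  then show ?case
    by (auto elim!: degree_eq_zeroE simp: map_poly_pCons intro!: exI[of _ "[]"])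
next
  case (Suc n)
  then obtain d where "poly p d = 0"
    using alg_closed_imp_poly_has_root[of p] by auto
  then obtain q where q: "p = [:- d, 1:] * q"
    by (auto simp: poly_eq_0_iff_dvd dvd_def)
  then have "q \<noteq> 0" using Suc.prems by auto
  then have "degree q = n"
    using Suc.hyps(2) unfolding q by (subst (asm) degree_mult_eq) auto
  then obtain c cs where IH: "c \<noteq> 0" "poly (map_poly \<iota> q) a = \<iota> c * (\<Prod>d\<leftarrow>cs. a - \<iota> d)"
    using Suc.hyps(1)[of q] \<open>q \<noteq> 0\<close> by auto
  have ev_add: "poly (map_poly \<iota> (f + g)) a = poly (map_poly \<iota> f) a + poly (map_poly \<iota> g) a" for f g
    by (simp add: map_poly_hom_add)
  have ev_smult: "poly (map_poly \<iota> (smult e f)) a = \<iota> e * poly (map_poly \<iota> f) a" for e f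
    by (induction f) (simp_all add: map_poly_pCons scalar_mult algebra_simps)
  have "poly (map_poly \<iota> p) a = (a - \<iota> d) * poly (map_poly \<iota> q) a"
    unfolding q mult_pCons_left ev_add ev_smult by (simp add: map_poly_pCons scalar_minus algebra_simps)
  then show ?case
    using IH by (intro exI[of _ c] exI[of _ "d # cs"]) (simp add: ac_simps)
qed

text \<open>
  The powers of \<open>a\<close> cannot all be linearly independent.
\<close>

lemma ex_annihilating_poly: "\<exists>p. p \<noteq> 0 \<and> poly (map_poly \<iota> p) a = 0"
  \<comment> \<open>Independence is a property of the set of powers and does not see repetitions.\<close>
proof (cases "inj (\<lambda>i. a ^ i)")
  case False
  then obtain i j where ij: "i \<noteq> j" "a ^ i = a ^ j" by (auto simp: inj_def)
  define p :: "'k poly" where "p = monom 1 i + monom (-1) j"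
  have "coeff p i = 1" using ij by (simp add: p_def)
  then have "p \<noteq> 0" by auto
  moreover have "poly (map_poly \<iota> p) a = 0"
    using ij by (simp add: p_def map_poly_hom_add map_poly_monom poly_monom scalar_minus)
  ultimately show ?thesis by blast
next
  case True
  define N where "N = {..vs.dimension}"
  have inj: "inj_on (\<lambda>i. a ^ i) N" using True by (rule inj_on_subset) simp
  have "\<not> vs.independent ((\<lambda>i. a ^ i) ` N)"
    using vs.independent_card_le_dim[of "(\<lambda>i. a ^ i) ` N" UNIV] card_image[OF inj]
    by (auto simp: N_def vs.dimension_def)
  then obtain u v where u: "(\<Sum>v\<in>(\<lambda>i. a ^ i) ` N. \<iota> (u v) * v) = 0"
      and v: "v \<in> (\<lambda>i. a ^ i) ` N" "u v \<noteq> 0"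
    by (auto simp: vs.dependent_finite N_def)
  define p where "p = (\<Sum>i\<in>N. monom (u (a ^ i)) i)"
  obtain i where i: "i \<in> N" "v = a ^ i" using v by auto
  have "coeff p i = u v" using i by (simp add: p_def coeff_sum N_def)
  then have "p \<noteq> 0" using v by auto
  have "poly (map_poly \<iota> (\<Sum>i\<in>M. monom (u (a ^ i)) i)) a = (\<Sum>i\<in>M. \<iota> (u (a ^ i)) * a ^ i)"
    if "finite M" for M
    using that by induction (simp_all add: map_poly_hom_add map_poly_monom poly_monom)
  then have "poly (map_poly \<iota> p) a = (\<Sum>i\<in>N. \<iota> (u (a ^ i)) * a ^ i)"
    by (simp add: p_def N_def)
  also have "\<dots> = 0" using u inj by (simp add: sum.reindex)
  finally show ?thesis using \<open>p \<noteq> 0\<close> by blast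
qed

text \<open>
  This is where the field being algebraically closed enters the structure of the algebra: it
  yields eigenvalues of multiplication operators and shows that all residue fields are \<open>k\<close>.
\<close>

lemma ex_split_annihilator: "\<exists>cs. (\<Prod>c\<leftarrow>cs. a - \<iota> c) = 0"
proof -
  obtain p where p: "p \<noteq> 0" "poly (map_poly \<iota> p) a = 0" using ex_annihilating_poly by blast
  obtain c cs where c: "c \<noteq> 0" "poly (map_poly \<iota> p) a = \<iota> c * (\<Prod>d\<leftarrow>cs. a - \<iota> d)"
    using eval_splits[OF p(1)] by blast
  then have "\<iota> (inverse c) * (\<iota> c * (\<Prod>d\<leftarrow>cs. a - \<iota> d)) = 0" using p by simp
  then show ?thesis using left_inverse[OF c(1)] by (auto simp flip: mult.assoc)
qed

lemma scale_right_cancel: "x \<noteq> 0 \<Longrightarrow> \<iota> c * x = \<iota> d * x \<longleftrightarrow> c = d"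
  using vs.scale_cancel_right[of c x d] by simp

section \<open>Characters and prime ideals\<close>

text \<open>
  The \<open>k\<close>-algebra homomorphisms \<open>A \<rightarrow> k\<close>, i.e. the \<open>k\<close>-points of the scheme.
\<close>

definition character :: "('a \<Rightarrow> 'k) \<Rightarrow> bool" where
  "character \<chi> \<longleftrightarrow> \<chi> \<in> dualizing \<iota> \<and> \<chi> 1 = 1 \<and> (\<forall>a b. \<chi> (a * b) = \<chi> a * \<chi> b)"

lemma dualizing_minus: "\<phi> \<in> dualizing \<iota> \<Longrightarrow> \<phi> (x - y) = \<phi> x - \<phi> y"
  using functional.linear_diff[of \<phi> x y] by (simp add: dualizing_def)

lemma dualizing_zero: "\<phi> \<in> dualizing \<iota> \<Longrightarrow> \<phi> 0 = 0"
  using functional.linear_0[of \<phi>] by (simp add: dualizing_def)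

lemma character_structure:
  assumes "character \<chi>"
  shows "\<chi> (\<iota> c) = c" "\<chi> (a * b) = \<chi> a * \<chi> b" "\<chi> 1 = 1" "\<chi> (a - b) = \<chi> a - \<chi> b"
    "\<chi> (a + b) = \<chi> a + \<chi> b" "\<chi> 0 = 0"
proof -
  have "\<chi> (\<iota> c * 1) = c * \<chi> 1"
    using assms unfolding character_def in_dualizing_iff by blast
  then show "\<chi> (\<iota> c) = c" using assms by (simp add: character_def)
qed (use assms in \<open>auto simp: character_def dualizing_minus dualizing_zero in_dualizing_iff\<close>)

text \<open>
  A character is determined by its values on a basis, and its value at \<open>a\<close> is a root of any
  polynomial that annihilates \<open>a\<close>.
\<close>

lemma finite_characters: "finite {\<chi>. character \<chi>}"
proof -
  obtain cs where cs: "(\<Prod>c\<leftarrow>cs a. a - \<iota> c) = 0" for a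
    using ex_split_annihilator by metis
  have root: "\<chi> a \<in> set (cs a)" if \<chi>: "character \<chi>" for \<chi> a
  proof -
    have "\<chi> (\<Prod>c\<leftarrow>ds. a - \<iota> c) = (\<Prod>c\<leftarrow>ds. \<chi> a - c)" for ds
      by (induction ds) (simp_all add: character_structure[OF \<chi>])
    then have "(\<Prod>c\<leftarrow>cs a. \<chi> a - c) = 0"
      using cs[of a] character_structure(6)[OF \<chi>] by metis
    then show ?thesis by (auto simp: prod_list_zero_iff)
  qed
  have "inj_on (\<lambda>\<chi>. restrict \<chi> basis) {\<chi>. character \<chi>}"
  proof (rule inj_onI, clarify)
    fix \<chi> \<chi>' assume ch: "character \<chi>" "character \<chi>'" and eq: "restrict \<chi> basis = restrict \<chi>' basis"
    have "\<chi> x = \<chi>' x" for x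
    proof (rule functional.linear_eq_on[of \<chi> \<chi>' x basis])
      show "\<chi> b = \<chi>' b" if "b \<in> basis" for b using eq that by (metis restrict_apply')
    qed (use ch vs.span_Basis in \<open>auto simp: character_def dualizing_def\<close>)
    then show "\<chi> = \<chi>'" by blast
  qed
  moreover have "(\<lambda>\<chi>. restrict \<chi> basis) ` {\<chi>. character \<chi>} \<subseteq> (\<Pi>\<^sub>E b\<in>basis. set (cs b))"
    using root by auto
  moreover have "finite (\<Pi>\<^sub>E b\<in>basis. set (cs b))"
    using vs.finite_Basis by (intro finite_PiE) auto
  ultimately show ?thesis using finite_imageD finite_subset by blast
qed

text \<open>
  A common source of characters: a functional relation \<open>P\<close>, read as "\<open>a\<close> acts as the scalar
  \<open>c\<close>", that is compatible with the algebra operations. It is applied to the action on a residue ring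
  \<open>A/p\<close> and to the action on a common eigenvector.
\<close>

lemma character_of_scalars:
  assumes ex: "\<And>a. \<exists>c. P a c" and unique: "\<And>a c d. P a c \<Longrightarrow> P a d \<Longrightarrow> c = d"
    and "P 1 1" "\<And>a b c d. P a c \<Longrightarrow> P b d \<Longrightarrow> P (a + b) (c + d)"
    and P_mult: "\<And>a b c d. P a c \<Longrightarrow> P b d \<Longrightarrow> P (a * b) (c * d)" and "\<And>c. P (\<iota> c) c"
  obtains \<chi> where "character \<chi>" "\<And>a c. P a c \<longleftrightarrow> \<chi> a = c"
proof -
  obtain \<chi> where \<chi>: "P a (\<chi> a)" for a using ex by metis
  then have iff: "P a c \<longleftrightarrow> \<chi> a = c" for a c using unique by blast
  have mul: "\<chi> (a * b) = \<chi> a * \<chi> b" for a b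
    using P_mult[OF \<chi>[of a] \<chi>[of b]] by (simp add: iff)
  have "character \<chi>"
    unfolding character_def in_dualizing_iff mul using assms(3,4,6) by (simp add: iff)
  then show ?thesis using that iff by blast
qed

text \<open>
  Since a product of factors \<open>a - c\<close> is zero, one of the factors lies in \<open>p\<close>; hence \<open>A/p = k\<close>.
\<close>

lemma prime_ideal_is_kernel:
  fixes p :: "'a set"
  assumes p: "prime_ideal p"
  shows "\<exists>\<chi>. character \<chi> \<and> p = {a. \<chi> a = 0}"
proof -
  have I: "ideal p" and prime: "\<And>a b. a * b \<in> p \<Longrightarrow> a \<in> p \<or> b \<in> p"
    using p by (auto simp: prime_ideal_def)
  have one_notin: "1 \<notin> p" by (rule one_notin_prime_ideal[OF p])
  have ex: "\<exists>c. a - \<iota> c \<in> p" for a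
  proof -
    obtain cs where "(\<Prod>c\<leftarrow>cs. a - \<iota> c) = 0" using ex_split_annihilator by blast
    then have "(\<Prod>c\<leftarrow>cs. a - \<iota> c) \<in> p" using I by (simp add: ideal_iff)
    then show ?thesis
      by (induction cs) (use one_notin prime in auto)
  qed
  have unique: "c = d" if "a - \<iota> c \<in> p" "a - \<iota> d \<in> p" for a c d
  proof (rule ccontr)
    assume "c \<noteq> d"
    have "(a - \<iota> d) - (a - \<iota> c) \<in> p" by (rule ideal_diff[OF I that(2,1)])
    then have "\<iota> (c - d) \<in> p" using scalar_add[of "c - d" d] by (simp add: algebra_simps)
    then have "\<iota> (inverse (c - d)) * \<iota> (c - d) \<in> p" using I unfolding ideal_iff by blast
    then show False using left_inverse[of "c - d"] \<open>c \<noteq> d\<close> one_notin by simp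
  qed
  have prod: "a * b - \<iota> (c * d) \<in> p" if "a - \<iota> c \<in> p" "b - \<iota> d \<in> p" for a b c d
  proof -
    have "b * (a - \<iota> c) + \<iota> c * (b - \<iota> d) \<in> p" using I that unfolding ideal_iff by blast
    then show ?thesis by (simp add: scalar_mult algebra_simps)
  qed
  have sum: "(a + b) - \<iota> (c + d) \<in> p" if "a - \<iota> c \<in> p" "b - \<iota> d \<in> p" for a b c d
  proof -
    have "(a - \<iota> c) + (b - \<iota> d) \<in> p" using I that unfolding ideal_iff by blast
    then show ?thesis by (simp add: scalar_add algebra_simps)
  qed
  have zero_in: "0 \<in> p" using I by (simp add: ideal_iff)
  obtain \<chi> where \<chi>: "character \<chi>" "\<And>a c. a - \<iota> c \<in> p \<longleftrightarrow> \<chi> a = c"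
    by (rule character_of_scalars[of "\<lambda>a c. a - \<iota> c \<in> p", OF ex unique _ sum prod])
      (use zero_in in auto)
  have "p = {a. \<chi> a = 0}" using \<chi>(2)[of _ 0] by auto
  with \<chi>(1) show ?thesis by blast
qed

lemma finite_prime_ideals: "finite {p :: 'a set. prime_ideal p}"
  using finite_characters
  by (rule finite_surj[of _ _ "\<lambda>\<chi>. {a. \<chi> a = 0}"]) (use prime_ideal_is_kernel in blast)

lemma kernel_is_prime: "character \<chi> \<Longrightarrow> prime_ideal {a. \<chi> a = 0}"
  using character_structure(3)[of \<chi>]
  by (auto simp: prime_ideal_def ideal_iff character_structure set_eq_iff intro: exI[of _ 1])

lemma dim_less_if_psubset:
  assumes "vs.subspace S" "vs.subspace T" "S \<subset> T"
  shows "vs.dim S < vs.dim T"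
  using vs.dim_psubset[of S T] assms vs.span_eq_iff by metis

text \<open>
  If \<open>I\<close> is not prime, say \<open>ab \<in> I\<close> with neither factor in \<open>I\<close>, then \<open>I + aA\<close> is larger and still
  proper, because \<open>1 = i + ay\<close> would give \<open>b = bi + aby \<in> I\<close>. Finite dimension ends the process.
\<close>

lemma ideal_le_prime:
  fixes I :: "'a set"
  assumes "ideal I" "1 \<notin> I"
  shows "\<exists>p. prime_ideal p \<and> I \<subseteq> p"
  using assms
proof (induction "vs.dimension - vs.dim I" arbitrary: I rule: less_induct)
  case less
  note I = \<open>ideal I\<close>
  show ?case
  proof (cases "prime_ideal I")
    case False
    then obtain a b where ab: "a * b \<in> I" "a \<notin> I" "b \<notin> I"
      using less.prems by (auto simp: prime_ideal_def)
    define J where "J = {i + a * y |i y. i \<in> I}"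
    have J: "ideal J"
      unfolding ideal_iff J_def
    proof (intro conjI ballI allI)
      show "0 \<in> {i + a * y |i y. i \<in> I}" using I by (auto simp: ideal_iff intro!: exI[of _ 0])
      fix u assume "u \<in> {i + a * y |i y. i \<in> I}"
      then obtain i y where u: "i \<in> I" "u = i + a * y" by blast
      show "c * u \<in> {i + a * y |i y. i \<in> I}" for c
        using I u by (intro CollectI exI[of _ "c * i"] exI[of _ "c * y"]) (simp add: ideal_iff algebra_simps)
      fix v assume "v \<in> {i + a * y |i y. i \<in> I}"
      then obtain j z where v: "j \<in> I" "v = j + a * z" by blast
      show "u + v \<in> {i + a * y |i y. i \<in> I}"
        using I u v by (intro CollectI exI[of _ "i + j"] exI[of _ "y + z"]) (simp add: ideal_iff algebra_simps)
    qed
    have "i + a * 0 \<in> J" if "i \<in> I" for i using that unfolding J_def by blast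
    then have IJ: "I \<subseteq> J" by auto
    have "0 + a * 1 \<in> J" using I unfolding J_def ideal_iff by blast
    with ab IJ have "I \<subset> J" by auto
    have "1 \<notin> J"
    proof
      assume "1 \<in> J"
      then obtain i y where "i \<in> I" "1 = i + a * y" by (auto simp: J_def)
      then have "b * i + y * (a * b) \<in> I" using ab I unfolding ideal_iff by blast
      also have "b * i + y * (a * b) = b * (i + a * y)" by (simp add: algebra_simps)
      finally show False using ab \<open>1 = i + a * y\<close> by simp
    qed
    moreover have "vs.dim I < vs.dim J"
      using I J \<open>I \<subset> J\<close> by (intro dim_less_if_psubset ideal_imp_subspace)
    moreover have "vs.dim J \<le> vs.dimension" by (rule vs.dim_subset_UNIV)
    ultimately obtain p where "prime_ideal p" "J \<subseteq> p"
      using less.hyps[OF diff_less_mono2, of J] J by force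
    with IJ show ?thesis by blast
  qed blast
qed

section \<open>One-dimensional ideals\<close>

text \<open>
  For a character \<open>\<chi>\<close> this is the annihilator of the maximal ideal \<open>ker \<chi>\<close>, the socle of \<open>A\<close> at that point.
\<close>

definition weight_space :: "('a \<Rightarrow> 'k) \<Rightarrow> 'a set" where
  "weight_space \<chi> = {x. \<forall>a. a * x = \<iota> (\<chi> a) * x}"

text \<open>
  Every \<open>a\<close> has an eigenvector in \<open>J\<close>: in the vanishing product \<open>(a - c\<^sub>1) \<cdots> (a - c\<^sub>n) x = 0\<close> some
  factor is the first to kill a nonzero vector. By commutativity the eigenspaces of \<open>a\<close>
  in \<open>J\<close> are ideals. Hence, if \<open>a\<close> does not scale a chosen \<open>x \<in> J\<close>, one of them is a smaller nonzero ideal.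
\<close>

lemma ex_weight_vector:
  assumes "ideal J" "J \<noteq> {0}"
  shows "\<exists>x\<in>J. x \<noteq> 0 \<and> (\<exists>\<chi>. character \<chi> \<and> x \<in> weight_space \<chi>)"
  using assms
proof (induction "vs.dim J" arbitrary: J rule: less_induct)
  case less
  note J = \<open>ideal J\<close>
  obtain x where x: "x \<in> J" "x \<noteq> 0" using less.prems by (auto simp: ideal_iff)
  show ?case
  proof (cases "\<forall>a. \<exists>c. a * x = \<iota> c * x")
    case True
    obtain \<chi> where \<chi>: "character \<chi>" "\<And>a c. a * x = \<iota> c * x \<longleftrightarrow> \<chi> a = c"
    proof (rule character_of_scalars[of "\<lambda>a c. a * x = \<iota> c * x", OF True[rule_format]])
      show "a * b * x = \<iota> (c * d) * x" if "a * x = \<iota> c * x" "b * x = \<iota> d * x" for a b c d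
        using that by (metis scalar_mult mult.assoc mult.left_commute)
    qed (use x in \<open>auto simp: scale_right_cancel scalar_add distrib_right\<close>)
    then have "x \<in> weight_space \<chi>" by (auto simp: weight_space_def)
    with x \<chi>(1) show ?thesis by blast
  next
    case False
    then obtain a where a: "\<And>c. a * x \<noteq> \<iota> c * x" by blast
    obtain cs where "(\<Prod>c\<leftarrow>cs. a - \<iota> c) = 0" using ex_split_annihilator by blast
    then have "(\<Prod>c\<leftarrow>cs. a - \<iota> c) * x = 0" by simp
    then have "\<exists>c y. y \<in> J \<and> y \<noteq> 0 \<and> (a - \<iota> c) * y = 0"
      using x
    proof (induction cs arbitrary: x)
      case (Cons c cs)
      show ?case
      proof (cases "(a - \<iota> c) * x = 0")
        case False
        have "(a - \<iota> c) * x \<in> J" using Cons.prems J by (simp add: ideal_iff)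
        with False show ?thesis
          using Cons.prems by (intro Cons.IH[of "(a - \<iota> c) * x"]) (simp_all add: ac_simps)
      qed (use Cons.prems in blast)
    qed simp
    then obtain c y where y: "y \<in> J" "y \<noteq> 0" "(a - \<iota> c) * y = 0" by blast
    define K where "K = {z \<in> J. (a - \<iota> c) * z = 0}"
    have K: "ideal K"
      using J by (auto simp: K_def ideal_iff distrib_left mult.left_commute[of "a - \<iota> c"])
    have "x \<notin> K" using a[of c] by (simp add: K_def left_diff_distrib)
    then have "K \<subset> J" using x by (auto simp: K_def)
    then have "vs.dim K < vs.dim J"
      using J K by (intro dim_less_if_psubset ideal_imp_subspace)
    moreover have "K \<noteq> {0}" using y by (auto simp: K_def)
    ultimately obtain z where "z \<in> K" "z \<noteq> 0" "\<exists>\<chi>. character \<chi> \<and> z \<in> weight_space \<chi>"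
      using less.hyps[of K] K by blast
    then show ?thesis using \<open>K \<subset> J\<close> by blast
  qed
qed

lemma line_of_weight_vector:
  assumes "x \<in> weight_space \<chi>" "x \<noteq> 0"
  shows "ideal (range (\<lambda>c. \<iota> c * x))" "vs.dim (range (\<lambda>c. \<iota> c * x)) = 1"
proof -
  have w: "a * x = \<iota> (\<chi> a) * x" for a using assms by (simp add: weight_space_def)
  have "vs.span {x} = range (\<lambda>c. \<iota> c * x)" by (simp add: vs.span_singleton)
  moreover have "a * (\<iota> c * x) = \<iota> (c * \<chi> a) * x" for a c
    using w[of a] by (metis scalar_mult mult.assoc mult.left_commute)
  then have "\<exists>d. a * (\<iota> c * x) = \<iota> d * x" for a c by blast
  moreover have "vs.subspace (vs.span {x})" by simp
  ultimately show "ideal (range (\<lambda>c. \<iota> c * x))" "vs.dim (range (\<lambda>c. \<iota> c * x)) = 1"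
    using vs.dim_span[of "{x}"] assms by (auto simp: ideal_iff subspace_iff image_iff)
qed

lemma ideal_dim_one:
  assumes "ideal I" "vs.dim I = 1"
  obtains x \<chi> where "x \<noteq> 0" "character \<chi>" "x \<in> weight_space \<chi>" "I = range (\<lambda>c. \<iota> c * x)"
proof -
  have "I \<noteq> {0}" using assms by auto
  then obtain x \<chi> where x: "x \<in> I" "x \<noteq> 0" "character \<chi>" "x \<in> weight_space \<chi>"
    using ex_weight_vector[OF assms(1)] by blast
  have "range (\<lambda>c. \<iota> c * x) = I"
    using assms x line_of_weight_vector[OF x(4,2)]
    by (intro vs.subspace_dim_equal ideal_imp_subspace) (auto simp: ideal_iff)
  with x that show ?thesis by blast
qed

text \<open>
  The Gorenstein condition is stated in the local ring at \<open>p = ker \<chi>\<close>, where it makes the socle cyclic; the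
  point is to clear the denominators and to obtain proportionality over \<open>k\<close> in \<open>A\<close> itself.
\<close>

lemma gorenstein_weight_space:
  assumes \<chi>: "character \<chi>" and gor: "gorenstein_at {a. \<chi> a = 0}"
    and x: "x \<in> weight_space \<chi>" "x \<noteq> 0"
  shows "weight_space \<chi> = range (\<lambda>c. \<iota> c * x)"
proof -
  let ?p = "{a. \<chi> a = 0}"
  have act: "a * y = \<iota> (\<chi> a) * y" if "y \<in> weight_space \<chi>" for a y
    using that by (simp add: weight_space_def)
  have socle: "in_socle_at ?p y" if "y \<in> weight_space \<chi>" for y
  proof -
    have "m * y = 0" if "\<chi> m = 0" for m using act[OF \<open>y \<in> weight_space \<chi>\<close>, of m] that by simp
    then show ?thesis
      using character_structure(3)[OF \<chi>] by (auto simp: in_socle_at_def vanishes_at_def intro!: exI[of _ 1])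
  qed
  obtain z where z: "in_socle_at ?p z"
    "\<And>y. in_socle_at ?p y \<Longrightarrow> \<exists>a t. t \<notin> ?p \<and> vanishes_at ?p (t * y - a * z)"
    using gor unfolding gorenstein_at_def by blast
  \<comment> \<open>Away from \<open>p\<close> an element acts on a weight vector by a nonzero scalar, so denominators cancel.\<close>
  have mult_z: "\<exists>c b. c \<noteq> 0 \<and> \<iota> c * y = b * z" if y: "y \<in> weight_space \<chi>" for y
  proof -
    obtain a t u where t: "\<chi> t \<noteq> 0" "\<chi> u \<noteq> 0" "u * (t * y - a * z) = 0"
      using z(2)[OF socle[OF y]] by (auto simp: vanishes_at_def)
    have "\<iota> (\<chi> (u * t)) * y = (u * a) * z"
      using t(3) act[OF y, of "u * t"] by (simp add: algebra_simps)
    moreover have "\<chi> (u * t) \<noteq> 0" using t character_structure[OF \<chi>] by simp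
    ultimately show ?thesis by blast
  qed
  \<comment> \<open>For \<open>b \<in> p\<close> the socle element \<open>b z\<close>, and with it \<open>y\<close>, would vanish at \<open>p\<close>.\<close>
  have nonzero: "\<chi> b \<noteq> 0" if y: "y \<in> weight_space \<chi>" "y \<noteq> 0" and b: "\<iota> c * y = b * z" "c \<noteq> 0" for y b c
  proof
    assume "\<chi> b = 0"
    then obtain t where t: "\<chi> t \<noteq> 0" "t * (b * z) = 0"
      using z(1) by (auto simp: in_socle_at_def vanishes_at_def)
    have "\<iota> (c * \<chi> t) * y = t * (b * z)"
      using act[OF y(1), of t] by (metis b(1) scalar_mult mult.assoc mult.left_commute)
    then have "\<iota> (c * \<chi> t) * y = \<iota> 0 * y" using t(2) by simp
    then show False using y(2) b(2) t(1) by (simp add: scale_right_cancel del: scalar_zero)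
  qed
  obtain c b where b: "c \<noteq> 0" "\<iota> c * x = b * z" using mult_z[OF x(1)] by blast
  show ?thesis
  proof (intro equalityI subsetI)
    fix y assume y: "y \<in> weight_space \<chi>"
    obtain d b' where b': "d \<noteq> 0" "\<iota> d * y = b' * z" using mult_z[OF y] by blast
    have "\<chi> b \<noteq> 0" by (rule nonzero[OF x b(2,1)])
    have "b * (\<iota> d * y) = b' * (\<iota> c * x)" unfolding b(2) b'(2) by (simp add: ac_simps)
    then have "\<iota> (d * \<chi> b) * y = \<iota> (c * \<chi> b') * x"
      using act[OF y, of b] act[OF x(1), of b'] by (metis scalar_mult mult.assoc mult.left_commute)
    then have "\<iota> e * (\<iota> (d * \<chi> b) * y) = \<iota> (e * (c * \<chi> b')) * x" for e
      unfolding scalar_mult[of e] mult.assoc by (rule arg_cong)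
    moreover have "\<iota> (inverse (d * \<chi> b)) * (\<iota> (d * \<chi> b) * y) = y"
      using left_inverse[of "d * \<chi> b"] \<open>\<chi> b \<noteq> 0\<close> b'(1) unfolding mult.assoc[symmetric] by simp
    ultimately have "y = \<iota> (inverse (d * \<chi> b) * (c * \<chi> b')) * x" by metis
    then show "y \<in> range (\<lambda>c. \<iota> c * x)" by blast
  next
    fix y assume "y \<in> range (\<lambda>c. \<iota> c * x)"
    then show "y \<in> weight_space \<chi>"
      using act[OF x(1)] by (auto simp: weight_space_def mult.left_commute)
  qed
qed

text \<open>
  A one-dimensional ideal consists of weight vectors of one character, hence is its full weight space.
\<close>

lemma finite_ideals_dim_one:
  assumes "\<And>p :: 'a set. prime_ideal p \<Longrightarrow> gorenstein_at p"
  shows "finite {I. ideal I \<and> vs.dim I = 1}"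
proof -
  have "\<exists>\<chi>. character \<chi> \<and> I = weight_space \<chi>" if "ideal I" "vs.dim I = 1" for I
    using that by (rule ideal_dim_one) (metis gorenstein_weight_space assms kernel_is_prime)
  then have "{I. ideal I \<and> vs.dim I = 1} \<subseteq> weight_space ` {\<chi>. character \<chi>}" by blast
  then show ?thesis using finite_characters by (blast intro: finite_surj)
qed

section \<open>Generators of line bundles\<close>

lemma ideal_not_in_any_prime:
  fixes I :: "'a set"
  assumes "ideal I" "\<And>p. prime_ideal p \<Longrightarrow> \<not> I \<subseteq> p"
  shows "1 \<in> I"
  using assms ideal_le_prime by blast

text \<open>
  A section \<open>u\<close> whose value is nonzero at each of the finitely many points exists since the field is
  infinite. It generates: for each section \<open>x\<close> the ideal of all \<open>c\<close> with \<open>c x \<in> A u\<close> is contained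
  in no prime ideal.
\<close>

lemma line_bundle_has_generator:
  fixes s :: "'a \<Rightarrow> 'l::ab_group_add \<Rightarrow> 'l"
  assumes L: "line_bundle s"
  shows "\<exists>g. generates s g"
proof -
  interpret L: module s using L by (simp add: line_bundle_def)
  interpret Lk: vector_space "kscale \<iota> s" by (rule vector_space_kscale[OF L.module_axioms])
  obtain f g where fg: "prime_ideal p \<Longrightarrow> f p \<notin> p" "prime_ideal p \<Longrightarrow> \<exists>n a. s (f p ^ n) x = s a (g p)"
      "prime_ideal p \<Longrightarrow> s a (g p) = 0 \<Longrightarrow> \<exists>n. f p ^ n * a = 0" for p x a
    using L unfolding line_bundle_def by metis
  have prime: "a \<in> p \<or> b \<in> p" if "prime_ideal p" "a * b \<in> p" for p :: "'a set" and a b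
    using that by (auto simp: prime_ideal_def)
  have power_notin: "f p ^ n \<notin> p" if p: "prime_ideal p" for p n
    by (rule power_notin_prime_ideal[OF p fg(1)[OF p]])
  \<comment> \<open>The sections whose value at the point \<open>p\<close> is zero.\<close>
  define N where "N p = {x. \<exists>n. \<exists>a\<in>p. s (f p ^ n) x = s a (g p)}" for p
  have N_subspace: "Lk.subspace (N p)" if p: "prime_ideal p" for p
  proof -
    have I: "ideal p" using p by (simp add: prime_ideal_def)
    show ?thesis
      unfolding Lk.subspace_def
    proof (intro conjI ballI allI)
      show "0 \<in> N p" using I by (auto simp: N_def ideal_iff intro!: exI[of _ 0] bexI[of _ 0])
      fix x assume "x \<in> N p"
      then obtain n a where x: "a \<in> p" "s (f p ^ n) x = s a (g p)" by (auto simp: N_def)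
      show "kscale \<iota> s c x \<in> N p" for c
      proof -
        have "s (f p ^ n) (s (\<iota> c) x) = s (\<iota> c * a) (g p)"
          using x(2) by (metis L.scale_left_commute L.scale_scale)
        moreover have "\<iota> c * a \<in> p" using I x(1) by (simp add: ideal_iff)
        ultimately show ?thesis unfolding N_def kscale_def by blast
      qed
      fix y assume "y \<in> N p"
      then obtain m b where y: "b \<in> p" "s (f p ^ m) y = s b (g p)" by (auto simp: N_def)
      have "s (f p ^ (n + m)) (x + y) = s (f p ^ m) (s (f p ^ n) x) + s (f p ^ n) (s (f p ^ m) y)"
        by (simp add: L.scale_right_distrib power_add mult.commute)
      also have "\<dots> = s (f p ^ m * a + f p ^ n * b) (g p)"
        by (simp add: x(2) y(2) L.scale_left_distrib)
      finally have "s (f p ^ (n + m)) (x + y) = s (f p ^ m * a + f p ^ n * b) (g p)" .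
      moreover have "f p ^ m * a + f p ^ n * b \<in> p" using I x(1) y(1) by (simp add: ideal_iff)
      ultimately show "x + y \<in> N p" unfolding N_def by blast
    qed
  qed
  \<comment> \<open>Otherwise \<open>f\<^sup>n - a\<close>, a unit at \<open>p\<close>, would annihilate the local basis \<open>g\<close>.\<close>
  have N_proper: "g p \<notin> N p" if p: "prime_ideal p" for p
  proof
    have I: "ideal p" using p by (simp add: prime_ideal_def)
    assume "g p \<in> N p"
    then obtain n a where a: "a \<in> p" "s (f p ^ n) (g p) = s a (g p)" by (auto simp: N_def)
    then have "s (f p ^ n - a) (g p) = 0" by (simp add: L.scale_left_diff_distrib)
    then obtain m where "f p ^ m * (f p ^ n - a) = 0" using fg(3)[OF p] by blast
    then have "f p ^ (m + n) = f p ^ m * a" by (simp add: algebra_simps power_add)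
    moreover have "f p ^ m * a \<in> p" using a(1) I by (simp add: ideal_iff)
    ultimately show False using power_notin[OF p] by metis
  qed
  have "\<exists>u\<in>UNIV. \<forall>S \<in> N ` {p. prime_ideal p}. u \<notin> S"
    using infinite_alg_closed_field finite_prime_ideals N_subspace N_proper
    by (intro Lk.avoid_finitely_many_subspaces) auto
  then obtain u where u: "\<And>p. prime_ideal p \<Longrightarrow> u \<notin> N p" by blast
  have "\<exists>a. x = s a u" for x
  proof -
    define J where "J = {c. \<exists>a. s c x = s a u}"
    have "ideal J"
      unfolding ideal_iff J_def
    proof (intro conjI ballI allI)
      show "0 \<in> {c. \<exists>a. s c x = s a u}" by (auto intro!: exI[of _ 0])
      fix c assume "c \<in> {c. \<exists>a. s c x = s a u}"
      then obtain a where a: "s c x = s a u" by blast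
      have "s (b * c) x = s (b * a) u" for b using a by (simp flip: L.scale_scale)
      then show "b * c \<in> {c. \<exists>a. s c x = s a u}" for b by blast
      fix d assume "d \<in> {c. \<exists>a. s c x = s a u}"
      then obtain b where "s d x = s b u" by blast
      with a have "s (c + d) x = s (a + b) u" by (simp add: L.scale_left_distrib)
      then show "c + d \<in> {c. \<exists>a. s c x = s a u}" by blast
    qed
    \<comment> \<open>At \<open>p\<close> the section \<open>u\<close> is a unit times the local basis, so \<open>x\<close> is a multiple of \<open>u\<close> there.\<close>
    moreover have "\<not> J \<subseteq> p" if p: "prime_ideal p" for p
    proof -
      obtain n a where a: "s (f p ^ n) u = s a (g p)" using fg(2)[OF p] by blast
      obtain m b where b: "s (f p ^ m) x = s b (g p)" using fg(2)[OF p] by blast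
      have "a \<notin> p" using u[OF p] a unfolding N_def by blast
      have "s (a * f p ^ m) x = s a (s b (g p))" using b by (simp flip: L.scale_scale)
      also have "\<dots> = s b (s a (g p))" by (simp add: mult.commute)
      also have "\<dots> = s (b * f p ^ n) u" by (simp flip: a)
      finally have "a * f p ^ m \<in> J" unfolding J_def by blast
      moreover have "a * f p ^ m \<notin> p" using prime[OF p] power_notin[OF p] \<open>a \<notin> p\<close> by blast
      ultimately show ?thesis by blast
    qed
    ultimately have "1 \<in> J" by (rule ideal_not_in_any_prime)
    then show ?thesis by (simp add: J_def)
  qed
  then show ?thesis using generates_iff[OF L.module_axioms] by blast
qed

text \<open>
  The annihilator of \<open>a\<close> is contained in no prime ideal, because near each point \<open>a\<close> kills
  the local basis.
\<close>

lemma line_bundle_generator_is_free: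
  fixes s :: "'a \<Rightarrow> 'l::ab_group_add \<Rightarrow> 'l"
  assumes L: "line_bundle s" and g: "generates s g" and "s a g = 0"
  shows "a = 0"
proof -
  interpret L: module s using L by (simp add: line_bundle_def)
  define J where "J = {c. c * a = 0}"
  have "ideal J" by (auto simp: J_def ideal_iff distrib_right mult.assoc)
  moreover have "\<not> J \<subseteq> p" if p: "prime_ideal p" for p
  proof -
    obtain f h where f: "f \<notin> p" and h: "\<And>b. s b h = 0 \<Longrightarrow> \<exists>n. f ^ n * b = 0"
      using L p unfolding line_bundle_def by metis
    obtain b where "h = s b g" using g generates_iff[OF L.module_axioms] by blast
    then have "s a h = s b (s a g)" by (simp add: mult.commute)
    then obtain n where "f ^ n * a = 0" using h assms(3) by auto
    have "f ^ n \<notin> p" by (rule power_notin_prime_ideal[OF p f])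
    then show ?thesis using \<open>f ^ n * a = 0\<close> by (auto simp: J_def)
  qed
  ultimately have "1 \<in> J" by (rule ideal_not_in_any_prime)
  then show ?thesis by (simp add: J_def)
qed

section \<open>Functionals that generate the dual\<close>

definition dualizing_generator :: "('a \<Rightarrow> 'k) \<Rightarrow> bool" where
  "dualizing_generator \<phi> \<longleftrightarrow> \<phi> \<in> dualizing \<iota> \<and> (\<forall>\<chi>\<in>dualizing \<iota>. \<exists>a. \<chi> = dual_act a \<phi>)"

text \<open>
  The functional \<open>b \<mapsto> \<phi>(ab)\<close>, encoded as a vector of \<open>A\<close> by its values on \<open>B\<close>. In this way
  \<open>a \<mapsto> a \<phi>\<close> becomes an endomorphism of \<open>A\<close>, and dimension counts in the dual space turn into
  dimension counts in \<open>A\<close>.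
\<close>

definition pairing_vector :: "'a set \<Rightarrow> ('a \<Rightarrow> 'k) \<Rightarrow> 'a \<Rightarrow> 'a" where
  "pairing_vector B \<phi> a = (\<Sum>e\<in>B. \<iota> (\<phi> (a * e)) * e)"

lemma dual_act_dualizing: "\<phi> \<in> dualizing \<iota> \<Longrightarrow> dual_act a \<phi> \<in> dualizing \<iota>"
  unfolding in_dualizing_iff dual_act_def by (metis distrib_left mult.left_commute)

lemma linear_pairing_vector:
  assumes "\<phi> \<in> dualizing \<iota>"
  shows "Vector_Spaces.linear (kscale \<iota> (*)) (kscale \<iota> (*)) (pairing_vector B \<phi>)"
  using assms
  by (auto simp: Vector_Spaces.linear_iff vs.vector_space_axioms pairing_vector_def in_dualizing_iff
      distrib_right scalar_add scalar_mult mult.assoc sum.distrib sum_distrib_left)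

lemma dualizing_eqI:
  assumes "\<phi> \<in> dualizing \<iota>" "\<psi> \<in> dualizing \<iota>" "vs.span B = UNIV" "\<And>e. e \<in> B \<Longrightarrow> \<phi> e = \<psi> e"
  shows "\<phi> = \<psi>"
  using functional.linear_eq_on[of \<phi> \<psi> _ B] assms by (fastforce simp: dualizing_def)

lemma basis_coefficients_unique:
  assumes "vs.independent B" "(\<Sum>e\<in>B. \<iota> (c e) * e) = (\<Sum>e\<in>B. \<iota> (d e) * e)" "e \<in> B"
  shows "c e = d e"
proof -
  have "(\<Sum>e\<in>B. \<iota> (c e - d e) * e) = 0"
    using assms(2) by (simp add: scalar_diff left_diff_distrib sum_subtractf)
  then show ?thesis
    using vs.independentD[OF assms(1) vs.finiteI_independent[OF assms(1)] order_refl, of "\<lambda>e. c e - d e" e]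
      assms(3) by simp
qed

lemma pairing_vector_eqI:
  assumes B: "vs.independent B" "vs.span B = UNIV" and \<phi>: "\<phi> \<in> dualizing \<iota>" "\<chi> \<in> dualizing \<iota>"
    and "pairing_vector B \<phi> a = (\<Sum>e\<in>B. \<iota> (\<chi> e) * e)"
  shows "\<chi> = dual_act a \<phi>"
proof (rule dualizing_eqI[OF \<phi>(2) dual_act_dualizing[OF \<phi>(1)] B(2)])
  show "\<chi> e = dual_act a \<phi> e" if "e \<in> B" for e
    using basis_coefficients_unique[OF B(1) _ that, of "\<lambda>e. \<phi> (a * e)" \<chi>] assms(5)
    by (simp add: pairing_vector_def dual_act_def)
qed

lemma inj_pairing_vector:
  assumes B: "vs.independent B" "vs.span B = UNIV" and \<phi>: "\<phi> \<in> dualizing \<iota>"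
    and nd: "\<And>a. (\<And>b. \<phi> (a * b) = 0) \<Longrightarrow> a = 0"
  shows "inj (pairing_vector B \<phi>)"
  unfolding endo.linear_inj_iff_eq_0[OF linear_pairing_vector[OF \<phi>]]
proof (intro allI impI)
  fix a assume "pairing_vector B \<phi> a = 0"
  then have "(\<lambda>_. 0) = dual_act a \<phi>"
    using B \<phi> by (intro pairing_vector_eqI) (auto simp: in_dualizing_iff)
  then show "a = 0" by (intro nd) (metis dual_act_def)
qed

text \<open>
  The map \<open>a \<mapsto> a \<phi>\<close> from \<open>A\<close> to its dual is surjective iff it is injective.
\<close>

lemma dualizing_generator_iff:
  assumes \<phi>: "\<phi> \<in> dualizing \<iota>"
  shows "dualizing_generator \<phi> \<longleftrightarrow> (\<forall>a. (\<forall>b. \<phi> (a * b) = 0) \<longrightarrow> a = 0)"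
proof
  note lin = linear_pairing_vector[OF \<phi>, of basis]
  assume gen: "dualizing_generator \<phi>"
  have "\<exists>a. y = pairing_vector basis \<phi> a" for y
  proof -
    obtain c where y: "y = (\<Sum>e\<in>basis. \<iota> (c e) * e)"
      using vs.span_finite[OF vs.finite_Basis] vs.span_Basis by (auto simp: set_eq_iff image_iff)
    obtain \<chi> where \<chi>: "\<chi> \<in> dualizing \<iota>" "\<And>e. e \<in> basis \<Longrightarrow> \<chi> e = c e"
      using functional.linear_independent_extend[OF vs.independent_Basis, of c]
      by (auto simp: dualizing_def)
    then obtain a where "\<chi> = dual_act a \<phi>" using gen by (auto simp: dualizing_generator_def)
    then have "pairing_vector basis \<phi> a = y"
      using \<chi>(2) by (simp add: y pairing_vector_def dual_act_def cong: sum.cong)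
    then show ?thesis by blast
  qed
  then have "surj (pairing_vector basis \<phi>)" unfolding surj_def by blast
  then have "inj (pairing_vector basis \<phi>)"
    by (rule vs.linear_surj_imp_inj[OF lin])
  moreover have "pairing_vector basis \<phi> a = pairing_vector basis \<phi> 0" if "\<forall>b. \<phi> (a * b) = 0" for a
    using that dualizing_zero[OF \<phi>] by (simp add: pairing_vector_def)
  ultimately show "\<forall>a. (\<forall>b. \<phi> (a * b) = 0) \<longrightarrow> a = 0" by (auto dest: injD)
next
  note lin = linear_pairing_vector[OF \<phi>, of basis]
  assume nd: "\<forall>a. (\<forall>b. \<phi> (a * b) = 0) \<longrightarrow> a = 0"
  then have "inj (pairing_vector basis \<phi>)"
    by (intro inj_pairing_vector[OF vs.independent_Basis vs.span_Basis \<phi>]) blast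
  then have "surj (pairing_vector basis \<phi>)" by (rule vs.linear_inj_imp_surj[OF lin])
  have "\<exists>a. \<chi> = dual_act a \<phi>" if \<chi>: "\<chi> \<in> dualizing \<iota>" for \<chi>
  proof -
    obtain a where "(\<Sum>e\<in>basis. \<iota> (\<chi> e) * e) = pairing_vector basis \<phi> a"
      using surjD[OF \<open>surj _\<close>] by blast
    from pairing_vector_eqI[OF vs.independent_Basis vs.span_Basis \<phi> \<chi> this[symmetric]] show ?thesis by blast
  qed
  then show "dualizing_generator \<phi>" using \<phi> by (simp add: dualizing_generator_def)
qed

text \<open>
  In a basis of \<open>A\<close> that extends a basis of \<open>W\<close>, the functionals \<open>b \<mapsto> \<phi>(ub)\<close> with \<open>u \<in> U\<close>
  have nonzero values only on the basis vectors added to that of \<open>W\<close>.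
\<close>

lemma dim_orthogonal_le:
  assumes \<phi>: "dualizing_generator \<phi>" and W: "vs.subspace W"
    and orth: "\<And>u w. u \<in> U \<Longrightarrow> w \<in> W \<Longrightarrow> \<phi> (u * w) = 0"
  shows "vs.dim U + vs.dim W \<le> vs.dim UNIV"
proof -
  have \<phi>': "\<phi> \<in> dualizing \<iota>" using \<phi> by (simp add: dualizing_generator_def)
  obtain C where C: "C \<subseteq> W" "vs.independent C" "W \<subseteq> vs.span C" "card C = vs.dim W"
    by (rule vs.basis_exists)
  let ?B = "vs.extend_basis C"
  have B: "vs.independent ?B" "vs.span ?B = UNIV" "C \<subseteq> ?B" "finite ?B"
    using C(2) by (simp_all add: vs.independent_extend_basis vs.extend_basis_superset vs.finiteI_independent)
  have "inj (pairing_vector ?B \<phi>)"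
    using \<phi> dualizing_generator_iff[OF \<phi>'] by (intro inj_pairing_vector[OF B(1,2) \<phi>']) blast
  then have "inj_on (pairing_vector ?B \<phi>) (vs.span U)" by (rule inj_on_subset) simp
  then have "vs.dim U = vs.dim (pairing_vector ?B \<phi> ` U)"
    by (rule endo.dim_image_eq[OF linear_pairing_vector[OF \<phi>'], symmetric])
  also have "\<dots> \<le> card (?B - C)"
  proof (rule vs.dim_le_card)
    show "pairing_vector ?B \<phi> ` U \<subseteq> vs.span (?B - C)"
    proof clarify
      fix u assume "u \<in> U"
      then have "pairing_vector ?B \<phi> u = (\<Sum>e\<in>?B - C. \<iota> (\<phi> (u * e)) * e)"
        unfolding pairing_vector_def using B(4) C(1) orth
        by (intro sum.mono_neutral_right) auto
      also have "\<dots> \<in> vs.span (?B - C)"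
        by (intro vs.span_sum) (metis vs.span_scale vs.span_base kscale_mult)
      finally show "pairing_vector ?B \<phi> u \<in> vs.span (?B - C)" .
    qed
  qed (use B in simp)
  also have "\<dots> = card ?B - card C" using B finite_subset by (intro card_Diff_subset) blast+
  finally have "vs.dim U \<le> card ?B - card C" .
  moreover have "card C \<le> card ?B" using B by (simp add: card_mono)
  moreover have "vs.dim UNIV = card ?B"
    using vs.dim_eq_card[of ?B UNIV] B by simp
  ultimately show ?thesis using C(4) by linarith
qed

text \<open>
  An isotropic subspace of half the dimension fills its orthogonal complement.
\<close>

lemma self_orthogonal_half_dimensional:
  assumes \<phi>: "dualizing_generator \<phi>" and W: "vs.subspace W" and half: "vs.dim UNIV = 2 * vs.dim W"
  shows "W = {a. \<forall>w\<in>W. \<phi> (a * w) = 0} \<longleftrightarrow> (\<forall>v\<in>W. \<forall>w\<in>W. \<phi> (v * w) = 0)"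
proof
  assume iso: "\<forall>v\<in>W. \<forall>w\<in>W. \<phi> (v * w) = 0"
  have \<phi>': "\<phi> \<in> dualizing \<iota>" using \<phi> by (simp add: dualizing_generator_def)
  then have "vs.subspace {a. \<forall>w\<in>W. \<phi> (a * w) = 0}"
    using dualizing_zero[OF \<phi>'] by (auto simp: subspace_iff in_dualizing_iff distrib_right mult.assoc)
  moreover have "vs.dim {a. \<forall>w\<in>W. \<phi> (a * w) = 0} + vs.dim W \<le> vs.dim UNIV"
    by (rule dim_orthogonal_le[OF \<phi> W]) blast
  ultimately show "W = {a. \<forall>w\<in>W. \<phi> (a * w) = 0}"
    using iso half W by (intro vs.subspace_dim_equal) auto
qed blast

lemma forms_two: "forms \<iota> W 2 = vs.span {v * w |v w. v \<in> W \<and> w \<in> W}"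
proof -
  have "{\<Prod>i<2. w i |w. \<forall>i<(2::nat). w i \<in> W} = {v * w |v w. v \<in> W \<and> w \<in> W}" (is "?L = ?R")
  proof (intro equalityI subsetI)
    fix x assume "x \<in> ?R"
    then obtain v w where "v \<in> W" "w \<in> W" "x = v * w" by blast
    then show "x \<in> ?L"
      by (intro CollectI exI[of _ "\<lambda>i. if i = 0 then v else w"]) (auto simp: numeral_2_eq_2)
  next
    fix x assume "x \<in> ?L"
    then obtain w where w: "x = (\<Prod>i<2. w i)" "\<forall>i<(2::nat). w i \<in> W" by blast
    then have "x = w 0 * w 1" "w 0 \<in> W" "w 1 \<in> W" by (simp_all add: numeral_2_eq_2)
    then show "x \<in> ?R" by blast
  qed
  then show ?thesis by (simp add: forms_def)
qed

lemma vanishes_on_forms_two: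
  assumes "\<phi> \<in> dualizing \<iota>"
  shows "(\<forall>y\<in>forms \<iota> W 2. \<phi> y = 0) \<longleftrightarrow> (\<forall>v\<in>W. \<forall>w\<in>W. \<phi> (v * w) = 0)"
proof
  assume "\<forall>v\<in>W. \<forall>w\<in>W. \<phi> (v * w) = 0"
  then have "\<phi> y = 0" if "y \<in> forms \<iota> W 2" for y
    using that functional.linear_eq_0_on_span[of \<phi> "{v * w |v w. v \<in> W \<and> w \<in> W}" y] assms
    by (auto simp: forms_two dualizing_def)
  then show "\<forall>y\<in>forms \<iota> W 2. \<phi> y = 0" by blast
qed (auto simp: forms_two intro: vs.span_base)

lemma ex_functional_separating:
  assumes Q: "vs.subspace Q" and "x \<notin> Q"
  shows "\<exists>\<phi>\<in>dualizing \<iota>. (\<forall>y\<in>Q. \<phi> y = 0) \<and> \<phi> x = 1"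
proof -
  obtain B where B: "B \<subseteq> Q" "vs.independent B" "Q \<subseteq> vs.span B" by (rule vs.basis_exists)
  have "vs.span B \<subseteq> Q" using B(1) Q by (rule vs.span_minimal)
  then have ind: "vs.independent (insert x B)" using B assms by (auto simp: vs.independent_insert)
  obtain \<phi> where \<phi>: "\<phi> \<in> dualizing \<iota>" "\<And>b. b \<in> insert x B \<Longrightarrow> \<phi> b = (if b = x then 1 else 0)"
    using functional.linear_independent_extend[OF ind, of "\<lambda>b. if b = x then 1 else 0"]
    unfolding dualizing_def by blast
  have "\<phi> y = 0" if "y \<in> Q" for y
  proof (rule functional.linear_eq_0_on_span[of \<phi> B y])
    show "Vector_Spaces.linear (kscale \<iota> (*)) (*) \<phi>" using \<phi>(1) by (simp add: dualizing_def)
    show "y \<in> vs.span B" using B(3) that by blast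
    show "\<phi> b = 0" if "b \<in> B" for b using \<phi>(2)[of b] B(1) assms(2) that by auto
  qed
  moreover have "\<phi> x = 1" using \<phi>(2)[of x] by simp
  ultimately show ?thesis using \<phi>(1) by blast
qed

text \<open>
  A functional generates the dual iff its kernel contains no nonzero ideal, and it suffices to
  test one-dimensional ideals. Finitely many conditions "not zero on \<open>I\<close>", each satisfiable
  within the annihilator of \<open>Q\<close>, are satisfiable simultaneously.
\<close>

lemma generator_vanishing_on_iff:
  assumes Q: "vs.subspace Q" and fin: "finite {I. ideal I \<and> vs.dim I = 1}"
  shows "(\<exists>\<phi>. dualizing_generator \<phi> \<and> (\<forall>y\<in>Q. \<phi> y = 0)) \<longleftrightarrow>
    (\<forall>I. ideal I \<and> vs.dim I = 1 \<longrightarrow> \<not> I \<subseteq> Q)"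
proof
  assume "\<exists>\<phi>. dualizing_generator \<phi> \<and> (\<forall>y\<in>Q. \<phi> y = 0)"
  then obtain \<phi> where \<phi>: "dualizing_generator \<phi>" "\<forall>y\<in>Q. \<phi> y = 0" by blast
  have \<phi>': "\<phi> \<in> dualizing \<iota>" using \<phi> by (simp add: dualizing_generator_def)
  show "\<forall>I. ideal I \<and> vs.dim I = 1 \<longrightarrow> \<not> I \<subseteq> Q"
  proof (intro allI impI notI; elim conjE)
    fix I assume I: "ideal I" "vs.dim I = 1" "I \<subseteq> Q"
    have "\<phi> (a * b) = 0" if "a \<in> I" for a b
    proof -
      have "b * a \<in> I" using I(1) that by (simp add: ideal_iff)
      then show ?thesis using \<phi>(2) I(3) by (auto simp: mult.commute)
    qed
    then have "I \<subseteq> {0}" using \<phi>(1) unfolding dualizing_generator_iff[OF \<phi>'] by blast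
    then show False using I(2) vs.dim_eq_0[of I] by simp
  qed
next
  assume min: "\<forall>I. ideal I \<and> vs.dim I = 1 \<longrightarrow> \<not> I \<subseteq> Q"
  interpret F: vector_space "\<lambda>(c::'k) (\<phi>::'a \<Rightarrow> 'k) x. c * \<phi> x"
    by (rule vector_space.intro) (simp_all add: fun_eq_iff distrib_left distrib_right)
  define U where "U = {\<phi>\<in>dualizing \<iota>. \<forall>y\<in>Q. \<phi> y = 0}"
  define S where "S I = {\<phi>::'a \<Rightarrow> 'k. \<forall>x\<in>I. \<phi> x = 0}" for I
  have "F.subspace U"
    unfolding F.subspace_def U_def in_dualizing_iff
    by (simp add: distrib_left mult.left_commute)
  moreover have "F.subspace (S I)" for I by (auto simp: F.subspace_def S_def)
  moreover have "\<not> U \<subseteq> S I" if I: "ideal I" "vs.dim I = 1" for I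
  proof -
    obtain x where x: "x \<in> I" "x \<notin> Q" using I min by blast
    then show ?thesis
      using ex_functional_separating[OF Q x(2)] unfolding U_def S_def by force
  qed
  ultimately have "\<exists>\<phi>\<in>U. \<forall>T\<in>S ` {I. ideal I \<and> vs.dim I = 1}. \<phi> \<notin> T"
    using infinite_alg_closed_field fin by (intro F.avoid_finitely_many_subspaces) auto
  then obtain \<phi> where \<phi>: "\<phi> \<in> U" "\<And>I. ideal I \<Longrightarrow> vs.dim I = 1 \<Longrightarrow> \<phi> \<notin> S I" by blast
  have \<phi>': "\<phi> \<in> dualizing \<iota>" using \<phi>(1) by (simp add: U_def)
  define J where "J = {a. \<forall>b. \<phi> (a * b) = 0}"
  have J: "ideal J"
    unfolding ideal_iff
  proof (intro conjI ballI allI)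
    show "0 \<in> J" using dualizing_zero[OF \<phi>'] by (simp add: J_def)
    fix x assume x: "x \<in> J"
    show "a * x \<in> J" for a
      using x unfolding J_def mem_Collect_eq by (metis mult.commute mult.assoc)
    show "x + y \<in> J" if "y \<in> J" for y
      using x that \<phi>' by (simp add: J_def in_dualizing_iff distrib_right)
  qed
  have "J = {0}"
  proof (rule ccontr)
    assume "J \<noteq> {0}"
    then obtain x \<chi> where x: "x \<in> J" "x \<noteq> 0" "x \<in> weight_space \<chi>"
      using ex_weight_vector[OF J] by blast
    have "\<phi> (x * \<iota> c) = 0" for c using x(1) by (simp add: J_def)
    then have "\<phi> \<in> S (range (\<lambda>c. \<iota> c * x))" by (auto simp: S_def mult.commute)
    then show False using \<phi>(2) line_of_weight_vector[OF x(3,2)] by blast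
  qed
  then have "dualizing_generator \<phi>" unfolding dualizing_generator_iff[OF \<phi>'] by (auto simp: J_def)
  then show "\<exists>\<phi>. dualizing_generator \<phi> \<and> (\<forall>y\<in>Q. \<phi> y = 0)" using \<phi>(1) by (auto simp: U_def)
qed

end

section \<open>Self-association in terms of a functional\<close>

locale free_line_bundle = finite_algebra \<iota>
  for \<iota> :: "'k::alg_closed_field \<Rightarrow> 'a::comm_ring_1" +
  fixes s :: "'a \<Rightarrow> 'l::ab_group_add \<Rightarrow> 'l" and g :: 'l
  assumes module_s: "module s" and generates_g: "generates s g"
    and free: "s a g = 0 \<Longrightarrow> a = 0"
begin

sublocale L: module s
  by (rule module_s)

lemma ex1_coord: "\<exists>!a. s a g = x"
proof -
  obtain a where "s a g = x" using generates_g generates_iff[OF module_s] by metis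
  moreover have "b = c" if "s b g = x" "s c g = x" for b c
    using free[of "b - c"] that by (simp add: L.scale_left_diff_distrib)
  ultimately show ?thesis by blast
qed

definition coord :: "'l \<Rightarrow> 'a" where
  "coord x = (THE a. s a g = x)"

lemma scale_coord [simp]: "s (coord x) g = x"
  unfolding coord_def by (rule theI'[OF ex1_coord])

lemma coord_scale [simp]: "coord (s a g) = a"
  using ex1_coord scale_coord by metis

lemma coord_g [simp]: "coord g = 1"
  using coord_scale[of 1] by simp

lemma coord_add: "coord (x + y) = coord x + coord y"
proof -
  have "s (coord x + coord y) g = x + y" by (simp only: L.scale_left_distrib scale_coord)
  then show ?thesis using coord_scale by metis
qed

lemma coord_mult: "coord (s a x) = a * coord x"
proof -
  have "s (a * coord x) g = s a x" by (simp only: scale_coord flip: L.scale_scale)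
  then show ?thesis using coord_scale by metis
qed

lemma coords_eq: "coords s g \<rho> = coord ` range \<rho>"
proof (intro equalityI subsetI)
  fix a assume "a \<in> coords s g \<rho>"
  then show "a \<in> coord ` range \<rho>" by (auto simp: coords_def) (metis coord_scale rangeI image_eqI)
qed (auto simp: coords_def)

lemma mem_coords_iff: "coord x \<in> coords s g \<rho> \<longleftrightarrow> x \<in> range \<rho>"
  by (simp add: coords_def)

lemma dual_act_dual_act: "dual_act a (dual_act b \<phi>) = dual_act (a * b) \<phi>"
  by (simp add: dual_act_def ac_simps fun_eq_iff)

lemma dualizing_twistD:
  assumes "\<psi> \<in> dualizing_twist \<iota> s"
  shows "\<psi> g \<in> dualizing \<iota>" "\<psi> x = dual_act (coord x) (\<psi> g)"
proof -
  have "\<psi> (s (coord x) g) = dual_act (coord x) (\<psi> g)"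
    using assms unfolding dualizing_twist_def by blast
  then show "\<psi> x = dual_act (coord x) (\<psi> g)" by (simp only: scale_coord)
qed (use assms in \<open>unfold dualizing_twist_def, blast\<close>)

text \<open>
  Since \<open>O\<^sub>\<Gamma>(1)\<close> is free on \<open>g\<close>, a homomorphism into the dualizing module can be prescribed by its
  value at \<open>g\<close>.
\<close>

lemma dualizing_twistI:
  assumes "\<phi> \<in> dualizing \<iota>"
  shows "(\<lambda>x. dual_act (coord x) \<phi>) \<in> dualizing_twist \<iota> s"
  unfolding dualizing_twist_def
proof (intro CollectI conjI allI)
  show "dual_act (coord x) \<phi> \<in> dualizing \<iota>" for x by (rule dual_act_dualizing[OF assms])
  have "\<phi> ((a + b) * c) = \<phi> (a * c) + \<phi> (b * c)" for a b c
    using assms unfolding in_dualizing_iff by (metis distrib_right)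
  then show "dual_act (coord (x + y)) \<phi> = dual_act (coord x) \<phi> + dual_act (coord y) \<phi>" for x y
    by (simp add: dual_act_def coord_add fun_eq_iff)
  show "dual_act (coord (s a x)) \<phi> = dual_act a (dual_act (coord x) \<phi>)" for a x
    unfolding coord_mult dual_act_dual_act ..
qed

text \<open>
  The functional is \<open>\<phi> = \<Phi>(g)(g)\<close>: linearity gives \<open>\<Phi>(ag)(bg) = ab \<phi>\<close>, so that \<open>\<Phi>(ag)\<close> lies in the
  Gale transform iff \<open>\<phi>(aw) = 0\<close> for all \<open>w\<close> in the image of \<open>V\<close>.
\<close>

lemma self_associated_imp_self_orthogonal:
  assumes "self_associated \<iota> s \<rho>"
  shows "\<exists>\<phi>. dualizing_generator \<phi> \<and>
    coords s g \<rho> = {a. \<forall>w\<in>coords s g \<rho>. \<phi> (a * w) = 0}"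
proof -
  obtain \<Phi> where bij: "bij_betw \<Phi> UNIV (dualizing_twist \<iota> s)"
    and mult: "\<And>a x. \<Phi> (s a x) = pointwise dual_act a (\<Phi> x)"
    and gale: "\<Phi> ` range \<rho> = gale_transform \<iota> s \<rho>"
    using assms unfolding self_associated_def by blast
  define \<phi> where "\<phi> = \<Phi> g g"
  have twist: "\<Phi> x \<in> dualizing_twist \<iota> s" for x using bij by (auto simp: bij_betw_def)
  have \<Phi>: "\<Phi> x y = dual_act (coord x * coord y) \<phi>" for x y
  proof -
    have "\<Phi> x y = \<Phi> (s (coord x) g) y" by simp
    also have "\<dots> = dual_act (coord x) (\<Phi> g y)" by (simp only: mult pointwise_def)
    also have "\<Phi> g y = dual_act (coord y) \<phi>"
      unfolding \<phi>_def by (rule dualizing_twistD(2)[OF twist])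
    finally show ?thesis by (simp add: dual_act_dual_act)
  qed
  have "\<phi> \<in> dualizing \<iota>" using twist unfolding \<phi>_def by (rule dualizing_twistD(1))
  moreover have "\<exists>a. \<chi> = dual_act a \<phi>" if \<chi>: "\<chi> \<in> dualizing \<iota>" for \<chi>
  proof -
    define \<psi> where "\<psi> = (\<lambda>x. dual_act (coord x) \<chi>)"
    have "\<psi> g = \<chi>" by (simp add: \<psi>_def dual_act_def)
    have "\<psi> \<in> dualizing_twist \<iota> s" unfolding \<psi>_def by (rule dualizing_twistI[OF \<chi>])
    then obtain x where "\<psi> = \<Phi> x" using bij by (auto simp: bij_betw_def)
    then have "\<chi> = dual_act (coord x) \<phi>" using \<open>\<psi> g = \<chi>\<close> \<Phi>[of x g] by simp
    then show ?thesis by blast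
  qed
  ultimately have "dualizing_generator \<phi>" by (simp add: dualizing_generator_def)
  moreover have "a \<in> coords s g \<rho> \<longleftrightarrow> (\<forall>w\<in>coords s g \<rho>. \<phi> (a * w) = 0)" for a
  proof -
    have "a \<in> coords s g \<rho> \<longleftrightarrow> s a g \<in> range \<rho>" by (simp add: coords_def)
    also have "\<dots> \<longleftrightarrow> \<Phi> (s a g) \<in> \<Phi> ` range \<rho>"
      using bij by (simp add: bij_betw_def inj_image_mem_iff)
    also have "\<dots> \<longleftrightarrow> (\<forall>v. \<phi> (a * coord (\<rho> v)) = 0)"
      using twist by (simp add: gale gale_transform_def trace_def \<Phi> dual_act_def)
    finally show ?thesis by (simp add: coords_eq)
  qed
  ultimately show ?thesis by blast
qed

text \<open>
  The isomorphism is given by the same formula \<open>\<Phi>(ag)(bg) = ab \<phi>\<close>.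
\<close>

lemma self_orthogonal_imp_self_associated:
  assumes \<phi>: "dualizing_generator \<phi>"
    and orth: "coords s g \<rho> = {a. \<forall>w\<in>coords s g \<rho>. \<phi> (a * w) = 0}"
  shows "self_associated \<iota> s \<rho>"
proof -
  have \<phi>': "\<phi> \<in> dualizing \<iota>" using \<phi> by (simp add: dualizing_generator_def)
  have nd: "a = 0" if "\<And>b. \<phi> (a * b) = 0" for a
    using \<phi> that unfolding dualizing_generator_iff[OF \<phi>'] by blast
  define \<Phi> where "\<Phi> x = (\<lambda>y. dual_act (coord x * coord y) \<phi>)" for x
  have twist: "\<Phi> x \<in> dualizing_twist \<iota> s" for x
    using dualizing_twistI[OF dual_act_dualizing[OF \<phi>', of "coord x"]]
    by (simp add: \<Phi>_def dual_act_dual_act mult.commute)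
  have "inj \<Phi>"
  proof (rule injI)
    fix x y assume "\<Phi> x = \<Phi> y"
    then have "\<Phi> x g b = \<Phi> y g b" for b by simp
    then have "\<phi> ((coord x - coord y) * b) = 0" for b
      by (simp add: \<Phi>_def dual_act_def left_diff_distrib dualizing_minus[OF \<phi>'])
    then have "coord x - coord y = 0" by (rule nd)
    then show "x = y" using scale_coord by (metis eq_iff_diff_eq_0)
  qed
  moreover have "\<psi> \<in> range \<Phi>" if \<psi>: "\<psi> \<in> dualizing_twist \<iota> s" for \<psi>
  proof -
    obtain a where a: "\<psi> g = dual_act a \<phi>"
      using \<phi> dualizing_twistD(1)[OF \<psi>] unfolding dualizing_generator_def by blast
    have "\<psi> x = \<Phi> (s a g) x" for x
      unfolding dualizing_twistD(2)[OF \<psi>, of x] by (simp add: a \<Phi>_def dual_act_dual_act mult.commute)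
    then have "\<psi> = \<Phi> (s a g)" by blast
    then show ?thesis by blast
  qed
  ultimately have "bij_betw \<Phi> UNIV (dualizing_twist \<iota> s)" using twist by (auto simp: bij_betw_def)
  moreover have "\<Phi> (x + y) = \<Phi> x + \<Phi> y" for x y
  proof -
    have "\<phi> ((a + b) * c) = \<phi> (a * c) + \<phi> (b * c)" for a b c
      using \<phi>' by (simp add: in_dualizing_iff distrib_right)
    then show ?thesis by (simp add: \<Phi>_def dual_act_def coord_add fun_eq_iff mult.assoc)
  qed
  moreover have "\<Phi> (s a x) = pointwise dual_act a (\<Phi> x)" for a x
    by (simp add: \<Phi>_def pointwise_def coord_mult dual_act_dual_act mult.assoc)
  moreover have "\<Phi> ` range \<rho> = gale_transform \<iota> s \<rho>"
  proof -
    have "\<Phi> x \<in> gale_transform \<iota> s \<rho> \<longleftrightarrow> (\<forall>w\<in>coords s g \<rho>. \<phi> (coord x * w) = 0)" for x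
      using twist by (simp add: gale_transform_def trace_def \<Phi>_def dual_act_def coords_eq)
    also have "\<dots> x \<longleftrightarrow> x \<in> range \<rho>" for x using orth mem_coords_iff[of x \<rho>] by blast
    finally have "\<Phi> x \<in> gale_transform \<iota> s \<rho> \<longleftrightarrow> x \<in> range \<rho>" for x .
    moreover have "gale_transform \<iota> s \<rho> \<subseteq> range \<Phi>"
      using \<open>bij_betw \<Phi> UNIV (dualizing_twist \<iota> s)\<close> by (auto simp: gale_transform_def bij_betw_def)
    ultimately show ?thesis by blast
  qed
  ultimately show ?thesis unfolding self_associated_def by blast
qed

section \<open>Conditions imposed on quadrics\<close>

text \<open>
  The section \<open>c g\<^sup>2\<close> of \<open>O\<^sub>\<Gamma>(2)\<close>, as the map \<open>\<theta> \<mapsto> \<theta>(g) c g\<close> on the inverse bundle. It identifies \<open>A\<close>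
  with \<open>H\<^sup>0(O\<^sub>\<Gamma>(2))\<close>.
\<close>

definition square_section :: "'a \<Rightarrow> (('l \<Rightarrow> 'a) \<Rightarrow> 'l)" where
  "square_section c = (\<lambda>\<theta>. if \<theta> \<in> inverse_bundle s then s (\<theta> g * c) g else 0)"

lemma inverse_bundle_iff:
  "\<theta> \<in> inverse_bundle s \<longleftrightarrow> (\<forall>x y. \<theta> (x + y) = \<theta> x + \<theta> y) \<and> (\<forall>a x. \<theta> (s a x) = a * \<theta> x)"
  by (simp add: inverse_bundle_def module_hom_iff module_s module_mult)

lemma coord_in_inverse_bundle: "coord \<in> inverse_bundle s"
  by (simp add: inverse_bundle_iff coord_add coord_mult)

lemma square_section_coord: "square_section c coord = s c g"
  using coord_in_inverse_bundle by (simp add: square_section_def)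

lemma inj_square_section: "inj square_section"
  by (rule injI) (metis square_section_coord coord_scale)

lemma square_section_add: "square_section (a + b) = square_section a + square_section b"
  by (auto simp: square_section_def distrib_left L.scale_left_distrib)

lemma square_section_mult: "square_section (a * b) = pointwise s a (square_section b)"
  by (auto simp: square_section_def pointwise_def mult.left_commute)

lemma square_mult_eq: "square_mult s x y = square_section (coord x * coord y)"
proof
  fix \<theta>
  show "square_mult s x y \<theta> = square_section (coord x * coord y) \<theta>"
  proof (cases "\<theta> \<in> inverse_bundle s")
    case True
    then have "\<theta> (s (coord x) g) = coord x * \<theta> g" unfolding inverse_bundle_iff by blast
    then have "\<theta> x = coord x * \<theta> g" by (simp only: scale_coord)
    moreover have "s (\<theta> x) y = s (\<theta> x * coord y) g" by (simp only: scale_coord flip: L.scale_scale)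
    ultimately have "s (\<theta> x) y = s (\<theta> g * (coord x * coord y)) g" by (simp only: ac_simps)
    with True show ?thesis by (simp add: square_mult_def square_section_def)
  qed (simp add: square_mult_def square_section_def)
qed

text \<open>
  The inverse bundle is free on \<open>coord\<close>, the element dual to \<open>g\<close>, so \<open>F\<close> is determined by its value
  there.
\<close>

lemma square_bundle_eq: "square_bundle s = range square_section"
proof (intro equalityI subsetI)
  fix F assume F: "F \<in> square_bundle s"
  have "F \<theta> = square_section (coord (F coord)) \<theta>" for \<theta>
  proof (cases "\<theta> \<in> inverse_bundle s")
    case True
    have "\<theta> x = \<theta> g * coord x" for x
    proof -
      have "\<theta> (s (coord x) g) = coord x * \<theta> g" using True unfolding inverse_bundle_iff by blast
      then show ?thesis by (simp only: scale_coord mult.commute)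
    qed
    then have "\<theta> = pointwise (*) (\<theta> g) coord" unfolding pointwise_def by (rule ext)
    moreover have "F (pointwise (*) a coord) = s a (F coord)" for a
      using F coord_in_inverse_bundle unfolding square_bundle_def by blast
    ultimately have "F \<theta> = s (\<theta> g) (F coord)" by metis
    also have "\<dots> = s (\<theta> g * coord (F coord)) g" by (simp only: scale_coord flip: L.scale_scale)
    finally show ?thesis using True by (simp add: square_section_def)
  qed (use F in \<open>simp add: square_bundle_def square_section_def\<close>)
  then show "F \<in> range square_section" by blast
next
  fix F assume "F \<in> range square_section"
  then obtain c where F: "F = square_section c" by blast
  have "\<theta> + \<eta> \<in> inverse_bundle s" "pointwise (*) a \<theta> \<in> inverse_bundle s"
    if "\<theta> \<in> inverse_bundle s" "\<eta> \<in> inverse_bundle s" for \<theta> \<eta> a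
    using that by (simp_all add: inverse_bundle_iff pointwise_def algebra_simps)
  then show "F \<in> square_bundle s"
    by (auto simp: F square_bundle_def square_section_def distrib_right L.scale_left_distrib)
      (auto simp: pointwise_def mult.assoc)
qed

sublocale sq: module "pointwise s :: 'a \<Rightarrow> (('l \<Rightarrow> 'a) \<Rightarrow> 'l) \<Rightarrow> _"
  by (rule module_pointwise[OF module_s])

sublocale sqk: vector_space "kscale \<iota> (pointwise s :: 'a \<Rightarrow> (('l \<Rightarrow> 'a) \<Rightarrow> 'l) \<Rightarrow> _)"
  by (rule vector_space_kscale[OF sq.module_axioms])

sublocale sq_pair: finite_dimensional_vector_space_pair_1 "kscale \<iota> (*)" basis
    "kscale \<iota> (pointwise s :: 'a \<Rightarrow> (('l \<Rightarrow> 'a) \<Rightarrow> 'l) \<Rightarrow> _)"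
  by (intro finite_dimensional_vector_space_pair_1.intro vs.finite_dimensional_vector_space_axioms
      sqk.vector_space_axioms)

lemma linear_square_section:
  "Vector_Spaces.linear (kscale \<iota> (*)) (kscale \<iota> (pointwise s)) square_section"
  unfolding Vector_Spaces.linear_iff kscale_def[of \<iota> "pointwise s"]
  using vs.vector_space_axioms sqk.vector_space_axioms
  by (simp add: square_section_add square_section_mult kscale_def[of \<iota> "pointwise s"])

lemma quadrics_eq: "quadrics \<iota> s \<rho> = square_section ` forms \<iota> (coords s g \<rho>) 2"
proof -
  have "{square_mult s (\<rho> v) (\<rho> w) |v w. True} =
      square_section ` {v * w |v w. v \<in> coords s g \<rho> \<and> w \<in> coords s g \<rho>}"
    by (fastforce simp: square_mult_eq coords_eq)
  then show ?thesis
    unfolding quadrics_def forms_two using sq_pair.linear_span_image[OF linear_square_section] by simp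
qed

lemma square_vanishing_eq:
  assumes "ideal I"
  shows "square_vanishing s I = square_section ` I"
proof -
  have "{pointwise s a F |a F. a \<in> I \<and> F \<in> square_bundle s} = square_section ` I"
  proof (intro equalityI subsetI)
    fix G assume "G \<in> {pointwise s a F |a F. a \<in> I \<and> F \<in> square_bundle s}"
    then obtain a c where a: "a \<in> I" "G = square_section (c * a)"
      by (auto simp: square_bundle_eq mult.commute simp flip: square_section_mult)
    then show "G \<in> square_section ` I" using assms by (auto simp: ideal_iff)
  next
    fix G assume "G \<in> square_section ` I"
    then obtain a where "a \<in> I" "G = pointwise s a (square_section 1)"
      by (auto simp flip: square_section_mult)
    then show "G \<in> {pointwise s a F |a F. a \<in> I \<and> F \<in> square_bundle s}"
      unfolding square_bundle_eq by blast
  qed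
  moreover have "sq.subspace (square_section ` I)"
    unfolding sq.subspace_def
  proof (intro conjI ballI allI)
    have "square_section 0 = 0" using square_section_add[of 0 0] by simp
    then show "0 \<in> square_section ` I" using assms by (force simp: ideal_iff)
  qed (use assms in \<open>auto simp: ideal_iff simp flip: square_section_add square_section_mult\<close>)
  ultimately show ?thesis by (simp add: square_vanishing_def sq.span_eq_iff)
qed

lemma dim_square_section: "sqk.dim (square_section ` S) = vs.dim S"
  by (rule sq_pair.dim_image_eq[OF linear_square_section]) (use inj_square_section in \<open>blast intro: inj_on_subset\<close>)

text \<open>
  By \<open>square_section\<close> the rank is \<open>dim (W\<^sup>2 + I) - dim I\<close> in \<open>A\<close>.
\<close>

lemma conditions_on_quadrics_eq:
  assumes I: "ideal I"
  shows "conditions_on_quadrics \<iota> s \<rho> I =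
    vs.dim (forms \<iota> (coords s g \<rho>) 2) - vs.dim (forms \<iota> (coords s g \<rho>) 2 \<inter> I)"
proof -
  let ?Q = "forms \<iota> (coords s g \<rho>) 2"
  have "{F + G |F G. F \<in> square_section ` ?Q \<and> G \<in> square_section ` I}
      = square_section ` {x + y |x y. x \<in> ?Q \<and> y \<in> I}"
    by (auto simp: image_iff) (metis square_section_add)+
  then have "conditions_on_quadrics \<iota> s \<rho> I = vs.dim {x + y |x y. x \<in> ?Q \<and> y \<in> I} - vs.dim I"
    by (simp add: conditions_on_quadrics_def quadrics_eq square_vanishing_eq[OF I] dim_square_section)
  moreover have "vs.dim {x + y |x y. x \<in> ?Q \<and> y \<in> I} + vs.dim (?Q \<inter> I) = vs.dim ?Q + vs.dim I"
    by (intro vs.dim_sums_Int ideal_imp_subspace[OF I]) (simp add: forms_two)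
  ultimately show ?thesis by linarith
qed

lemma same_conditions_iff:
  assumes I: "ideal I" "vs.dim I = 1"
  shows "conditions_on_quadrics \<iota> s \<rho> I = conditions_on_quadrics \<iota> s \<rho> {0} \<longleftrightarrow>
    \<not> I \<subseteq> forms \<iota> (coords s g \<rho>) 2"
proof -
  let ?Q = "forms \<iota> (coords s g \<rho>) 2"
  have Q: "vs.subspace ?Q" by (simp add: forms_two)
  have "ideal {0 :: 'a}" by (simp add: ideal_iff)
  moreover have "vs.dim (?Q \<inter> {0}) = 0" unfolding vs.dim_eq_0 by blast
  ultimately have "conditions_on_quadrics \<iota> s \<rho> {0} = vs.dim ?Q"
    by (simp only: conditions_on_quadrics_eq diff_zero)
  moreover have "vs.dim (?Q \<inter> I) \<le> vs.dim ?Q" by (rule vs.dim_subset) blast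
  ultimately have "conditions_on_quadrics \<iota> s \<rho> I = conditions_on_quadrics \<iota> s \<rho> {0} \<longleftrightarrow>
      vs.dim (?Q \<inter> I) = 0"
    unfolding conditions_on_quadrics_eq[OF I(1)] by linarith
  also have "\<dots> \<longleftrightarrow> \<not> I \<subseteq> ?Q"
  proof
    assume "vs.dim (?Q \<inter> I) = 0"
    show "\<not> I \<subseteq> ?Q"
    proof
      assume "I \<subseteq> ?Q"
      then have "?Q \<inter> I = I" by blast
      then show False using \<open>vs.dim (?Q \<inter> I) = 0\<close> I(2) by simp
    qed
  next
    assume "\<not> I \<subseteq> ?Q"
    then have "?Q \<inter> I \<subset> I" by blast
    moreover have "vs.subspace (?Q \<inter> I)"
      by (rule vs.subspace_inter[OF Q ideal_imp_subspace[OF I(1)]])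
    ultimately have "vs.dim (?Q \<inter> I) < vs.dim I"
      using ideal_imp_subspace[OF I(1)] by (intro dim_less_if_psubset)
    then show "vs.dim (?Q \<inter> I) = 0" using I(2) by simp
  qed
  finally show ?thesis .
qed

section \<open>The equivalences\<close>

lemma half_dimensional_self_associated_iff:
  assumes W: "vs.subspace (coords s g \<rho>)" and half: "vs.dim UNIV = 2 * vs.dim (coords s g \<rho>)"
  shows "self_associated \<iota> s \<rho> \<longleftrightarrow>
    (\<exists>\<phi>. dualizing_generator \<phi> \<and> (\<forall>y\<in>forms \<iota> (coords s g \<rho>) 2. \<phi> y = 0))"
proof -
  have "self_associated \<iota> s \<rho> \<longleftrightarrow>
      (\<exists>\<phi>. dualizing_generator \<phi> \<and> coords s g \<rho> = {a. \<forall>w\<in>coords s g \<rho>. \<phi> (a * w) = 0})"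
    using self_associated_imp_self_orthogonal self_orthogonal_imp_self_associated by blast
  moreover have "coords s g \<rho> = {a. \<forall>w\<in>coords s g \<rho>. \<phi> (a * w) = 0} \<longleftrightarrow>
      (\<forall>y\<in>forms \<iota> (coords s g \<rho>) 2. \<phi> y = 0)" if \<phi>: "dualizing_generator \<phi>" for \<phi>
    unfolding self_orthogonal_half_dimensional[OF \<phi> W half]
    using \<phi> by (intro vanishes_on_forms_two[symmetric]) (simp add: dualizing_generator_def)
  ultimately show ?thesis by blast
qed

lemma linear_coord: "Vector_Spaces.linear (kscale \<iota> s) (kscale \<iota> (*)) coord"
  using vector_space_kscale[OF module_s] vs.vector_space_axioms
  by (simp add: Vector_Spaces.linear_iff coord_add coord_mult kscale_def[of \<iota> s])

lemma coords_of_embedding: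
  assumes V: "vector_space sV" and fin: "vector_space.dim sV (UNIV :: 'v set) > 0"
    and \<rho>: "Vector_Spaces.linear sV (kscale \<iota> s) (\<rho> :: 'v::ab_group_add \<Rightarrow> 'l)" "inj \<rho>"
  shows "vs.subspace (coords s g \<rho>)" "vs.dim (coords s g \<rho>) = vector_space.dim sV (UNIV :: 'v set)"
proof -
  interpret V: vector_space sV by (rule V)
  obtain B where B: "V.independent B" "V.span B = UNIV" "card B = V.dim UNIV"
    using V.basis_exists[of UNIV] by (metis top.extremum_uniqueI)
  have "finite B" using B(3) fin by (metis card.infinite less_irrefl)
  interpret V: finite_dimensional_vector_space sV B
    using B \<open>finite B\<close> by unfold_locales auto
  interpret pair: finite_dimensional_vector_space_pair_1 sV B "kscale \<iota> (*)"
    by unfold_locales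
  have lin: "Vector_Spaces.linear sV (kscale \<iota> (*)) (coord \<circ> \<rho>)"
    by (rule Vector_Spaces.linear_compose[OF \<rho>(1) linear_coord])
  have eq: "coords s g \<rho> = (coord \<circ> \<rho>) ` UNIV" by (simp add: coords_eq image_comp)
  show "vs.subspace (coords s g \<rho>)"
    unfolding eq by (rule pair.linear_subspace_image[OF lin]) simp
  have "inj coord" by (rule injI) (metis scale_coord)
  then have "inj_on (coord \<circ> \<rho>) (V.span UNIV)" using \<rho>(2) by (simp add: inj_compose)
  then show "vs.dim (coords s g \<rho>) = V.dim UNIV"
    unfolding eq by (rule pair.dim_image_eq[OF lin])
qed

end

theorem theorem7p1:
  fixes \<iota> :: "'k::alg_closed_field \<Rightarrow> 'a::comm_ring_1"
    and s :: "'a \<Rightarrow> 'l::ab_group_add \<Rightarrow> 'l"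
    and sV :: "'k \<Rightarrow> 'v::ab_group_add \<Rightarrow> 'v"
    and \<rho> :: "'v \<Rightarrow> 'l"
    and r :: nat
  assumes "vector_space sV" and "vector_space.dim sV (UNIV :: 'v set) = r + 1"
    and "finite_gorenstein_scheme \<iota>"
    and "projective_embedding \<iota> s sV \<rho>"
    and "nondegenerate \<rho>"
    and "vector_space.dim (kscale \<iota> (*)) (UNIV :: 'a set) = 2 * r + 2"
  shows "finite {I. module.subspace (*) I \<and> subscheme_degree \<iota> I = 2 * r + 1}
    \<and> (self_associated \<iota> s \<rho> \<longleftrightarrow>
        (\<forall>I. module.subspace (*) I \<and> subscheme_degree \<iota> I = 2 * r + 1 \<longrightarrow>
           conditions_on_quadrics \<iota> s \<rho> I = conditions_on_quadrics \<iota> s \<rho> {0}))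
    \<and> (self_associated \<iota> s \<rho> \<longleftrightarrow>
        (\<forall>g. generates s g \<longrightarrow>
           (\<exists>\<phi>\<in>dualizing \<iota>. (\<forall>y\<in>forms \<iota> (coords s g \<rho>) 2. \<phi> y = 0) \<and>
              (\<forall>\<chi>\<in>dualizing \<iota>. \<exists>a. \<chi> = dual_act a \<phi>))))"
proof -
  interpret finite_algebra \<iota>
    using assms(3) by unfold_locales (simp add: finite_gorenstein_scheme_def)
  have L: "line_bundle s" and \<rho>: "Vector_Spaces.linear sV (kscale \<iota> s) \<rho>" "inj \<rho>"
    using assms(4,5) by (auto simp: projective_embedding_def nondegenerate_def)
  have degree_iff: "subscheme_degree \<iota> I = 2 * r + 1 \<longleftrightarrow> vs.dim I = 1" for I
    using assms(6) unfolding subscheme_degree_def by linarith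
  have "finite {I. ideal I \<and> vs.dim I = 1}"
    using assms(3) by (intro finite_ideals_dim_one) (simp add: finite_gorenstein_scheme_def)
  \<comment> \<open>Self-association does not mention a generator, so these criteria hold for one generator iff for all.\<close>
  moreover have self_assoc_iff: "self_associated \<iota> s \<rho> \<longleftrightarrow>
      (\<exists>\<phi>. dualizing_generator \<phi> \<and> (\<forall>y\<in>forms \<iota> (coords s g \<rho>) 2. \<phi> y = 0))"
    and conditions_iff: "\<And>I. ideal I \<Longrightarrow> vs.dim I = 1 \<Longrightarrow>
      conditions_on_quadrics \<iota> s \<rho> I = conditions_on_quadrics \<iota> s \<rho> {0} \<longleftrightarrow>
      \<not> I \<subseteq> forms \<iota> (coords s g \<rho>) 2"
    if g: "generates s g" for g
  proof -
    interpret free_line_bundle \<iota> s g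
    proof (intro free_line_bundle.intro free_line_bundle_axioms.intro finite_algebra_axioms g)
      show "module s" using L by (simp add: line_bundle_def)
    qed (rule line_bundle_generator_is_free[OF L g])
    show "self_associated \<iota> s \<rho> \<longleftrightarrow>
      (\<exists>\<phi>. dualizing_generator \<phi> \<and> (\<forall>y\<in>forms \<iota> (coords s g \<rho>) 2. \<phi> y = 0))"
      using coords_of_embedding[OF assms(1) _ \<rho>] assms(2,6)
      by (intro half_dimensional_self_associated_iff) simp_all
    show "conditions_on_quadrics \<iota> s \<rho> I = conditions_on_quadrics \<iota> s \<rho> {0} \<longleftrightarrow>
      \<not> I \<subseteq> forms \<iota> (coords s g \<rho>) 2" if "ideal I" "vs.dim I = 1" for I
      using that by (rule same_conditions_iff)
  qed
  moreover obtain g where g: "generates s g" using line_bundle_has_generator[OF L] by blast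
  ultimately have "self_associated \<iota> s \<rho> \<longleftrightarrow> (\<forall>I. ideal I \<and> vs.dim I = 1 \<longrightarrow>
      conditions_on_quadrics \<iota> s \<rho> I = conditions_on_quadrics \<iota> s \<rho> {0})"
    using generator_vanishing_on_iff[of "forms \<iota> (coords s g \<rho>) 2"] by (simp add: forms_two)
  moreover have "self_associated \<iota> s \<rho> \<longleftrightarrow> (\<forall>g. generates s g \<longrightarrow>
      (\<exists>\<phi>. dualizing_generator \<phi> \<and> (\<forall>y\<in>forms \<iota> (coords s g \<rho>) 2. \<phi> y = 0)))"
    using self_assoc_iff g by blast
  ultimately show ?thesis
    using \<open>finite {I. ideal I \<and> vs.dim I = 1}\<close> unfolding degree_iff dualizing_generator_def by blast
qed

end
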